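(* Let $k\in\mathbb Z_+$. Each element of the set $$\bigl\{h_{i_1}\otimes\cdots\otimes h_{i_k}:\ i_1,\dots,i_k\in\{+,-\},\ \#\{j:i_j=+\}=\#\{j:i_j=-\}\bigr\}$$ extends to a global section $M\to E^{\otimes k}$ and is parallel. The set forms a basis of $\Pi(E^{\otimes k})$.
   Context: $M$ is a two-dimensional, connected, complete, orientable Riemannian manifold of constant sectional curvature $K\neq0$. $E=\mathbb C\otimes_{\mathbb R}TM$ is the complexified tangent bundle with complex-linearly extended Levi-Civita connection; tensor products are over $\mathbb C$, and $\Pi(E^{\otimes k})$ denotes the complex vector space of global parallel sections of $E^{\otimes k}$. Fix $p\in M$ and let $\{e_1,e_2\}$ be an orthonormal basis of $T_pM$. For some neighborhood $V$ of $p$, local sections $X_1,X_2:V\to TV$ are defined by parallel transporting $e_1,e_2$ to every $q\in V$ (no particular paths being prescribed), and $h_+=X_1-\sqrt{-1}X_2$, $h_-=X_1+\sqrt{-1}X_2$ are the resulting local sections of $E$. *)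

theory Defs
  imports "HOL-Analysis.Analysis" "HOL-Library.Function_Algebras"
begin

section \<open>Smooth functions of two real variables\<close>

definition partial :: "2 \<Rightarrow> (real^2 \<Rightarrow> 'b::real_normed_vector) \<Rightarrow> real^2 \<Rightarrow> 'b" where
  "partial i f x = frechet_derivative f (at x) (axis i 1)"

primrec Ck_on :: "nat \<Rightarrow> (real^2) set \<Rightarrow> (real^2 \<Rightarrow> 'b::real_normed_vector) \<Rightarrow> bool" where
  "Ck_on 0 U f \<longleftrightarrow> continuous_on U f"
| "Ck_on (Suc n) U f \<longleftrightarrow> (\<forall>x\<in>U. f differentiable (at x)) \<and> (\<forall>i. Ck_on n U (partial i f))"

text \<open>Only used for open sets \<open>U\<close>.\<close>

definition smooth_on :: "(real^2) set \<Rightarrow> (real^2 \<Rightarrow> 'b::real_normed_vector) \<Rightarrow> bool" where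
  "smooth_on U f \<longleftrightarrow> (\<forall>n. Ck_on n U f)"


section \<open>Smooth surfaces\<close>

text \<open>A chart is a pair of its domain and its coordinate map; the values of the coordinate map
  outside the domain are irrelevant.\<close>

type_synonym 'a chart = "'a set \<times> ('a \<Rightarrow> real^2)"

abbreviation cdom :: "'a chart \<Rightarrow> 'a set" where "cdom c \<equiv> fst c"
abbreviation coord :: "'a chart \<Rightarrow> 'a \<Rightarrow> real^2" where "coord c \<equiv> snd c"
abbreviation cimg :: "'a chart \<Rightarrow> (real^2) set" where "cimg c \<equiv> coord c ` cdom c"
abbreviation param :: "'a chart \<Rightarrow> real^2 \<Rightarrow> 'a" where "param c \<equiv> inv_into (cdom c) (coord c)"

definition is_chart :: "'a topology \<Rightarrow> 'a chart \<Rightarrow> bool" where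
  "is_chart M c \<longleftrightarrow> openin M (cdom c) \<and> open (cimg c) \<and>
     homeomorphic_map (subtopology M (cdom c)) (top_of_set (cimg c)) (coord c)"

definition transition :: "'a chart \<Rightarrow> 'a chart \<Rightarrow> real^2 \<Rightarrow> real^2" where
  "transition c d = coord d \<circ> param c"

definition compatible :: "'a chart \<Rightarrow> 'a chart \<Rightarrow> bool" where
  "compatible c d \<longleftrightarrow>
     smooth_on (coord c ` (cdom c \<inter> cdom d)) (transition c d) \<and>
     smooth_on (coord d ` (cdom c \<inter> cdom d)) (transition d c)"

text \<open>The smooth structure is given as a maximal atlas.\<close>

definition smooth_surface :: "'a topology \<Rightarrow> 'a chart set \<Rightarrow> bool" where
  "smooth_surface M A \<longleftrightarrow>
     Hausdorff_space M \<and> second_countable M \<and>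
     (\<forall>c\<in>A. is_chart M c) \<and> (\<Union>c\<in>A. cdom c) = topspace M \<and>
     (\<forall>c\<in>A. \<forall>d\<in>A. compatible c d) \<and>
     (\<forall>c. is_chart M c \<longrightarrow> (\<forall>d\<in>A. compatible c d) \<longrightarrow> c \<in> A)"

definition charts_at :: "'a chart set \<Rightarrow> 'a \<Rightarrow> 'a chart set" where
  "charts_at A q = {c \<in> A. q \<in> cdom c}"

definition jacobian :: "'a chart \<Rightarrow> 'a chart \<Rightarrow> 'a \<Rightarrow> real^2^2" where
  "jacobian c d q = matrix (frechet_derivative (transition c d) (at (coord c q)))"

definition orientable_surface :: "'a topology \<Rightarrow> 'a chart set \<Rightarrow> bool" where
  "orientable_surface M A \<longleftrightarrow>
     (\<exists>B\<subseteq>A. (\<Union>c\<in>B. cdom c) = topspace M \<and>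
        (\<forall>c\<in>B. \<forall>d\<in>B. \<forall>q\<in>cdom c \<inter> cdom d. det (jacobian c d q) > 0))"

text \<open>A tangent vector at \<open>q\<close> is its family of components, one for every chart around \<open>q\<close>,
  subject to the transformation law; the value \<open>0\<close> at all other arguments is a normalisation
  that makes equality of such families equality of tangent vectors.\<close>

type_synonym 'a tvec = "'a chart \<Rightarrow> real^2"

definition tangent_space :: "'a chart set \<Rightarrow> 'a \<Rightarrow> 'a tvec set" where
  "tangent_space A q =
     {v. (\<forall>c. c \<notin> charts_at A q \<longrightarrow> v c = 0) \<and>
         (\<forall>c\<in>charts_at A q. \<forall>d\<in>charts_at A q. v d = jacobian c d q *v v c)}"


section \<open>Riemannian metrics and the Levi-Civita connection\<close>

text \<open>\<open>g c x\<close> is the Gram matrix of the metric in the chart \<open>c\<close> at the coordinate point \<open>x\<close>.\<close>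

type_synonym 'a metric_tensor = "'a chart \<Rightarrow> real^2 \<Rightarrow> real^2^2"

definition riemannian_metric :: "'a chart set \<Rightarrow> 'a metric_tensor \<Rightarrow> bool" where
  "riemannian_metric A g \<longleftrightarrow>
     (\<forall>c\<in>A. \<forall>i j. smooth_on (cimg c) (\<lambda>x. g c x $ i $ j)) \<and>
     (\<forall>c\<in>A. \<forall>x\<in>cimg c. transpose (g c x) = g c x \<and> (\<forall>v. v \<noteq> 0 \<longrightarrow> v \<bullet> (g c x *v v) > 0)) \<and>
     (\<forall>c\<in>A. \<forall>d\<in>A. \<forall>q\<in>cdom c \<inter> cdom d.
        g c (coord c q) = transpose (jacobian c d q) ** g d (coord d q) ** jacobian c d q)"

definition riemannian_surface :: "'a topology \<Rightarrow> 'a chart set \<Rightarrow> 'a metric_tensor \<Rightarrow> bool" where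
  "riemannian_surface M A g \<longleftrightarrow> smooth_surface M A \<and> riemannian_metric A g"

definition ip :: "'a metric_tensor \<Rightarrow> 'a chart \<Rightarrow> real^2 \<Rightarrow> real^2 \<Rightarrow> real^2 \<Rightarrow> real" where
  "ip g c x u v = u \<bullet> (g c x *v v)"

definition orthonormal_basis_at ::
  "'a chart set \<Rightarrow> 'a metric_tensor \<Rightarrow> 'a \<Rightarrow> 'a tvec \<Rightarrow> 'a tvec \<Rightarrow> bool" where
  "orthonormal_basis_at A g q u v \<longleftrightarrow>
     u \<in> tangent_space A q \<and> v \<in> tangent_space A q \<and>
     (\<forall>c\<in>charts_at A q. ip g c (coord c q) (u c) (u c) = 1 \<and>
        ip g c (coord c q) (v c) (v c) = 1 \<and> ip g c (coord c q) (u c) (v c) = 0)"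

text \<open>The coefficient \<open>\<Gamma>\<close> with upper index \<open>i\<close> and lower indices \<open>j\<close>, \<open>k\<close> of the Levi-Civita
  connection, i.e. the \<open>i\<close>-th component of the derivative of the \<open>k\<close>-th coordinate field in
  the \<open>j\<close>-th coordinate direction.\<close>

definition christoffel :: "'a metric_tensor \<Rightarrow> 'a chart \<Rightarrow> real^2 \<Rightarrow> 2 \<Rightarrow> 2 \<Rightarrow> 2 \<Rightarrow> real" where
  "christoffel g c x i j k =
     (\<Sum>l\<in>UNIV. matrix_inv (g c x) $ i $ l *
        (partial j (\<lambda>y. g c y $ k $ l) x + partial k (\<lambda>y. g c y $ j $ l) x
          - partial l (\<lambda>y. g c y $ j $ k) x)) / 2"

definition connection_form ::
  "'a metric_tensor \<Rightarrow> 'a chart \<Rightarrow> real^2 \<Rightarrow> real^2 \<Rightarrow> real^2 \<Rightarrow> real^2" where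
  "connection_form g c x u v =
     (\<chi> i. \<Sum>j\<in>UNIV. \<Sum>k\<in>UNIV. christoffel g c x i j k * u $ j * v $ k)"

text \<open>Component \<open>l\<close> of \<open>R(\<partial>\<^sub>i, \<partial>\<^sub>j) \<partial>\<^sub>k\<close>, where
  \<open>R(X,Y)Z = \<nabla>\<^sub>X \<nabla>\<^sub>Y Z - \<nabla>\<^sub>Y \<nabla>\<^sub>X Z - \<nabla>\<^bsub>[X,Y]\<^esub> Z\<close>.\<close>

definition riemann ::
  "'a metric_tensor \<Rightarrow> 'a chart \<Rightarrow> real^2 \<Rightarrow> 2 \<Rightarrow> 2 \<Rightarrow> 2 \<Rightarrow> 2 \<Rightarrow> real" where
  "riemann g c x l i j k =
     partial i (\<lambda>y. christoffel g c y l j k) x - partial j (\<lambda>y. christoffel g c y l i k) x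
     + (\<Sum>m\<in>UNIV. christoffel g c x l i m * christoffel g c x m j k
                - christoffel g c x l j m * christoffel g c x m i k)"

definition curvature_operator ::
  "'a metric_tensor \<Rightarrow> 'a chart \<Rightarrow> real^2 \<Rightarrow> real^2 \<Rightarrow> real^2 \<Rightarrow> real^2 \<Rightarrow> real^2" where
  "curvature_operator g c x X Y Z =
     (\<chi> l. \<Sum>i\<in>UNIV. \<Sum>j\<in>UNIV. \<Sum>k\<in>UNIV. riemann g c x l i j k * X $ i * Y $ j * Z $ k)"

definition sectional_curvature ::
  "'a metric_tensor \<Rightarrow> 'a chart \<Rightarrow> real^2 \<Rightarrow> real^2 \<Rightarrow> real^2 \<Rightarrow> real" where
  "sectional_curvature g c x X Y =
     ip g c x (curvature_operator g c x X Y Y) X /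
       (ip g c x X X * ip g c x Y Y - (ip g c x X Y)\<^sup>2)"

definition constant_sectional_curvature :: "'a chart set \<Rightarrow> 'a metric_tensor \<Rightarrow> real \<Rightarrow> bool" where
  "constant_sectional_curvature A g K \<longleftrightarrow>
     (\<forall>c\<in>A. \<forall>x\<in>cimg c. \<forall>X Y. X \<noteq> Y \<and> independent {X, Y} \<longrightarrow> sectional_curvature g c x X Y = K)"


section \<open>Parallel transport and geodesics\<close>

text \<open>\<open>Y\<close> is a vector field along the curve \<open>\<gamma>\<close>; its covariant derivative along \<open>\<gamma>\<close> exists
  and vanishes at the parameter \<open>t\<close>.\<close>

definition parallel_at ::
  "'a chart set \<Rightarrow> 'a metric_tensor \<Rightarrow> (real \<Rightarrow> 'a) \<Rightarrow> (real \<Rightarrow> 'a tvec) \<Rightarrow> real \<Rightarrow> bool" where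
  "parallel_at A g \<gamma> Y t \<longleftrightarrow>
     (\<forall>c\<in>charts_at A (\<gamma> t).
        ((\<lambda>s. Y s c) has_vector_derivative
           - connection_form g c (coord c (\<gamma> t)) (vector_derivative (coord c \<circ> \<gamma>) (at t)) (Y t c))
        (at t))"

text \<open>The chartwise analogue of \<^const>\<open>piecewise_C1_differentiable_on\<close>.\<close>

definition piecewise_C1_path :: "'a topology \<Rightarrow> 'a chart set \<Rightarrow> (real \<Rightarrow> 'a) \<Rightarrow> bool" where
  "piecewise_C1_path M A \<gamma> \<longleftrightarrow>
     continuous_map (top_of_set {0..1}) M \<gamma> \<and>
     (\<exists>S. finite S \<and>
        (\<forall>c\<in>A. (coord c \<circ> \<gamma>) C1_differentiable_on {t \<in> {0..1} - S. \<gamma> t \<in> cdom c}))"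

definition parallel_transport ::
  "'a chart set \<Rightarrow> 'a metric_tensor \<Rightarrow> (real \<Rightarrow> 'a) \<Rightarrow> 'a tvec \<Rightarrow> 'a tvec \<Rightarrow> bool" where
  "parallel_transport A g \<gamma> v w \<longleftrightarrow>
     (\<exists>Y S. Y 0 = v \<and> Y 1 = w \<and>
        (\<forall>t\<in>{0..1}. Y t \<in> tangent_space A (\<gamma> t)) \<and>
        (\<forall>c\<in>A. continuous_on {t \<in> {0..1}. \<gamma> t \<in> cdom c} (\<lambda>t. Y t c)) \<and>
        finite S \<and> (\<forall>t\<in>{0..1} - S. parallel_at A g \<gamma> Y t))"

definition has_velocity :: "'a chart set \<Rightarrow> (real \<Rightarrow> 'a) \<Rightarrow> real \<Rightarrow> 'a tvec \<Rightarrow> bool" where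
  "has_velocity A \<gamma> t v \<longleftrightarrow> v \<in> tangent_space A (\<gamma> t) \<and>
     (\<forall>c\<in>charts_at A (\<gamma> t). ((coord c \<circ> \<gamma>) has_vector_derivative v c) (at t))"

definition geodesically_complete ::
  "'a topology \<Rightarrow> 'a chart set \<Rightarrow> 'a metric_tensor \<Rightarrow> bool" where
  "geodesically_complete M A g \<longleftrightarrow>
     (\<forall>q\<in>topspace M. \<forall>v\<in>tangent_space A q. \<exists>\<gamma> W.
        continuous_map euclideanreal M \<gamma> \<and> \<gamma> 0 = q \<and> W 0 = v \<and>
        (\<forall>t. has_velocity A \<gamma> t (W t) \<and> parallel_at A g \<gamma> W t))"


section \<open>Tensor powers of the complexified tangent bundle\<close>

text \<open>An element of the \<open>k\<close>-th tensor power over \<open>\<complex>\<close> of the complexified tangent space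
  \<open>E\<^sub>q = \<complex> \<otimes> T\<^sub>q M\<close> is its family of components: for every chart \<open>c\<close> around \<open>q\<close> and every
  multi-index \<open>w\<close> of length \<open>k\<close>, the coefficient \<open>t c w\<close> of
  \<open>\<partial>\<^bsub>w!0\<^esub> \<otimes> \<dots> \<otimes> \<partial>\<^bsub>w!(k-1)\<^esub>\<close>, subject to the transformation law.  As for tangent vectors, the
  components are normalised to \<open>0\<close> at all other arguments.\<close>

type_synonym 'a ctensor = "'a chart \<Rightarrow> 2 list \<Rightarrow> complex"

definition tensor_fibre :: "'a chart set \<Rightarrow> nat \<Rightarrow> 'a \<Rightarrow> 'a ctensor set" where
  "tensor_fibre A k q =
     {t. (\<forall>c w. c \<notin> charts_at A q \<or> length w \<noteq> k \<longrightarrow> t c w = 0) \<and>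
         (\<forall>c\<in>charts_at A q. \<forall>d\<in>charts_at A q. \<forall>w. length w = k \<longrightarrow>
            t d w = (\<Sum>u | length u = k.
               (\<Prod>j<k. complex_of_real (jacobian c d q $ (w ! j) $ (u ! j))) * t c u))}"

text \<open>The tensor product of a list of elements of \<open>E\<^sub>q\<close>, each given by its components.\<close>

definition tensor_product :: "('a chart \<Rightarrow> complex^2) list \<Rightarrow> 'a ctensor" where
  "tensor_product vs = (\<lambda>c w. if length w = length vs then \<Prod>j<length vs. (vs ! j) c $ (w ! j) else 0)"

type_synonym 'a tsection = "'a \<Rightarrow> 'a ctensor"

definition local_rep :: "'a tsection \<Rightarrow> 'a chart \<Rightarrow> 2 list \<Rightarrow> real^2 \<Rightarrow> complex" where
  "local_rep s c w x = s (param c x) c w"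

definition global_sections :: "'a topology \<Rightarrow> 'a chart set \<Rightarrow> nat \<Rightarrow> 'a tsection set" where
  "global_sections M A k =
     {s. (\<forall>q\<in>topspace M. s q \<in> tensor_fibre A k q) \<and>
         (\<forall>q. q \<notin> topspace M \<longrightarrow> s q = 0) \<and>
         (\<forall>c\<in>A. \<forall>w. length w = k \<longrightarrow> smooth_on (cimg c) (local_rep s c w))}"

text \<open>Component \<open>w\<close> of the covariant derivative of \<open>s\<close> in the \<open>j\<close>-th coordinate direction; the
  connection acts on the tensor power by the Leibniz rule, one Christoffel term per factor.\<close>

definition covariant_derivative ::
  "'a metric_tensor \<Rightarrow> 'a tsection \<Rightarrow> 'a chart \<Rightarrow> 2 \<Rightarrow> 2 list \<Rightarrow> real^2 \<Rightarrow> complex" where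
  "covariant_derivative g s c j w x =
     partial j (local_rep s c w) x
     + (\<Sum>m<length w. \<Sum>l\<in>UNIV.
          complex_of_real (christoffel g c x (w ! m) j l) * local_rep s c (w[m := l]) x)"

definition parallel_sections ::
  "'a topology \<Rightarrow> 'a chart set \<Rightarrow> 'a metric_tensor \<Rightarrow> nat \<Rightarrow> 'a tsection set" where
  "parallel_sections M A g k =
     {s \<in> global_sections M A k.
        \<forall>c\<in>A. \<forall>x\<in>cimg c. \<forall>j w. length w = k \<longrightarrow> covariant_derivative g s c j w x = 0}"

text \<open>Addition of sections is the pointwise one of \<^theory>\<open>HOL-Library.Function_Algebras\<close>.\<close>

definition section_scale :: "complex \<Rightarrow> 'a tsection \<Rightarrow> 'a tsection" where
  "section_scale a s = (\<lambda>q c w. a * s q c w)"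

interpretation sections: vector_space section_scale
  by unfold_locales (auto simp: section_scale_def fun_eq_iff algebra_simps)


section \<open>The fields \<open>h\<^sub>+\<close>, \<open>h\<^sub>-\<close> and their balanced tensor products\<close>

datatype sign = Plus | Minus

fun h_vec :: "'a tvec \<Rightarrow> 'a tvec \<Rightarrow> sign \<Rightarrow> 'a chart \<Rightarrow> complex^2" where
  "h_vec X1 X2 Plus c = (\<chi> i. complex_of_real (X1 c $ i) - \<i> * complex_of_real (X2 c $ i))"
| "h_vec X1 X2 Minus c = (\<chi> i. complex_of_real (X1 c $ i) + \<i> * complex_of_real (X2 c $ i))"

definition h_tensor :: "('a \<Rightarrow> 'a tvec) \<Rightarrow> ('a \<Rightarrow> 'a tvec) \<Rightarrow> sign list \<Rightarrow> 'a tsection" where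
  "h_tensor X1 X2 I = (\<lambda>q. tensor_product (map (h_vec (X1 q) (X2 q)) I))"

definition balanced_words :: "nat \<Rightarrow> sign list set" where
  "balanced_words k = {I. length I = k \<and> count_list I Plus = count_list I Minus}"

end

theory Submission
  imports Defs
begin

text \<open>A local orthonormal frame \<open>u, v\<close> satisfies \<open>\<nabla>u = \<alpha> v\<close>, \<open>\<nabla>v = - \<alpha> u\<close> for a one-form \<open>\<alpha>\<close>, so
  \<open>h\<^sub>+ = u - \<i> v\<close> and \<open>h\<^sub>- = u + \<i> v\<close> satisfy \<open>\<nabla>h\<^sub>+ = \<i> \<alpha> h\<^sub>+\<close>, \<open>\<nabla>h\<^sub>- = - \<i> \<alpha> h\<^sub>-\<close>, and a rotation of the frame
  multiplies them by opposite phases.  Hence a product \<open>h\<^sub>I\<close> with as many plus as minus signs is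
  parallel and depends only on the orientation of the frame.  Since \<open>M\<close> is oriented, these
  products are globally defined; parallel transport along any path preserves oriented
  orthonormal frames, so they extend the sections of the theorem.  Conversely, write a parallel section
  locally as \<open>\<Sum> a\<^sub>I h\<^sub>I\<close>.  Then \<open>da\<^sub>I = - \<i> n \<alpha> a\<^sub>I\<close>, where \<open>n\<close> is the difference of the numbers
  of plus and minus signs in \<open>I\<close>, and the symmetry of second derivatives gives \<open>n a\<^sub>I d\<alpha> = 0\<close>.
  As the curvature does not vanish, \<open>d\<alpha> \<noteq> 0\<close>; so only balanced \<open>I\<close> occur and their
  coefficients are locally constant, hence constant because \<open>M\<close> is connected.\<close>


section \<open>Calculus with partial derivatives in the plane\<close>

text \<open>The fields \<open>X1\<close>, \<open>X2\<close> come from arbitrarily chosen paths, so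
  their continuity in the point is never at hand, and an orthonormal frame cannot in general be
  continued over the whole surface. Therefore no frame is extended: at each point an arbitrary
  oriented orthonormal frame is picked, and smoothness of a balanced product is read off from the
  Gram-Schmidt frame of a chart, an explicit smooth formula up to a sign that fixes the orientation.
  The link between curvature and d\<alpha> is the commutator identity R(d_1, d_2) h_s = \<i> s
  (d\<alpha>)_12 h_s with s = 1 or -1: if d\<alpha> vanished at a point, so would the whole Riemann
  tensor there. Coefficients are isolated by pairing with a dual frame. The products are independent
  at every single point, so two constant-coefficient combinations that agree at one point coincide.
  This drives both the continuation over the connected surface and the uniqueness of each
  extension.\<close>

lemma partial_eq: "(f has_derivative D) (at x) \<Longrightarrow> partial i f x = D (axis i 1)"
  by (simp add: partial_def frechet_derivative_at[symmetric])

text \<open>The two functions have the same candidate derivatives at \<open>x\<close>, so the choice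
  inside \<open>frechet_derivative\<close> is the same even where neither is differentiable.\<close>

lemma partial_cong:
  assumes "open U" "x \<in> U" "\<And>y. y \<in> U \<Longrightarrow> f y = g y"
  shows "partial i f x = partial i g x"
proof -
  have "(f has_derivative D) (at x) \<longleftrightarrow> (g has_derivative D) (at x)" for D
    using assms has_derivative_transform_within_open[of f D x UNIV U g]
      has_derivative_transform_within_open[of g D x UNIV U f] by metis
  then show ?thesis
    by (simp add: partial_def frechet_derivative_def)
qed

lemma differentiable_cong_open:
  assumes "open U" "x \<in> U" "\<And>y. y \<in> U \<Longrightarrow> f y = g y"
  shows "f differentiable (at x) \<longleftrightarrow> g differentiable (at x)"
  using assms has_derivative_transform_within_open[of f _ x UNIV U g]
    has_derivative_transform_within_open[of g _ x UNIV U f] unfolding differentiable_def by metis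

lemma has_derivative_partial:
  fixes f :: "real^2 \<Rightarrow> 'b::real_normed_vector"
  assumes "f differentiable (at x)"
  shows "(f has_derivative (\<lambda>h. \<Sum>i\<in>UNIV. h $ i *\<^sub>R partial i f x)) (at x)"
proof -
  let ?D = "frechet_derivative f (at x)"
  have D: "(f has_derivative ?D) (at x)"
    using assms by (simp add: frechet_derivative_works[symmetric])
  then have lin: "linear ?D"
    by (rule has_derivative_linear)
  have "?D h = (\<Sum>i\<in>UNIV. h $ i *\<^sub>R partial i f x)" for h
  proof -
    have "?D h = ?D (\<Sum>i\<in>UNIV. h $ i *\<^sub>R axis i 1)"
      by (simp add: basis_expansion flip: scalar_mult_eq_scaleR)
    also have "\<dots> = (\<Sum>i\<in>UNIV. h $ i *\<^sub>R partial i f x)"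
      by (simp add: linear_sum[OF lin] linear_scale[OF lin] partial_def)
    finally show ?thesis .
  qed
  then have "?D = (\<lambda>h. \<Sum>i\<in>UNIV. h $ i *\<^sub>R partial i f x)" by blast
  with D show ?thesis by simp
qed

section \<open>Differentiation rules for partial derivatives\<close>

lemma partial_const [simp]: "partial i (\<lambda>_. c) x = 0"
  by (rule partial_eq) (rule has_derivative_const)

lemma partial_linear:
  assumes "bounded_linear L" "f differentiable (at x)"
  shows "partial i (\<lambda>x. L (f x)) x = L (partial i f x)"
proof -
  have "((\<lambda>x. L (f x)) has_derivative (\<lambda>h. L (frechet_derivative f (at x) h))) (at x)"
    using assms bounded_linear.has_derivative frechet_derivative_works by blast
  from partial_eq[OF this] show ?thesis
    by (simp add: partial_def)
qed

lemma partial_bilinear: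
  assumes "bounded_bilinear m" "f differentiable (at x)" "h differentiable (at x)"
  shows "partial i (\<lambda>x. m (f x) (h x)) x = m (f x) (partial i h x) + m (partial i f x) (h x)"
proof -
  have "((\<lambda>x. m (f x) (h x)) has_derivative
      (\<lambda>v. m (f x) (frechet_derivative h (at x) v) + m (frechet_derivative f (at x) v) (h x))) (at x)"
    by (intro bounded_bilinear.FDERIV assms assms[unfolded frechet_derivative_works])
  from partial_eq[OF this] show ?thesis
    by (simp add: partial_def)
qed

lemma differentiable_linear:
  assumes "bounded_linear L" "f differentiable F"
  shows "(\<lambda>x. L (f x)) differentiable F"
  using assms bounded_linear.has_derivative unfolding differentiable_def by blast

lemma differentiable_bilinear:
  assumes "bounded_bilinear m" "f differentiable (at x within S)" "h differentiable (at x within S)"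
  shows "(\<lambda>x. m (f x) (h x)) differentiable (at x within S)"
  using assms bounded_bilinear.FDERIV unfolding differentiable_def by blast

lemmas partial_mult = partial_bilinear[OF bounded_bilinear_mult]
lemmas partial_of_real = partial_linear[OF bounded_linear_of_real]
lemmas partial_cmult = partial_linear[OF bounded_linear_mult_right]
lemmas differentiable_of_real = differentiable_linear[OF bounded_linear_of_real]

lemma partial_add:
  assumes "f differentiable (at x)" "h differentiable (at x)"
  shows "partial i (\<lambda>x. f x + h x) x = partial i f x + partial i h x"
  using partial_eq[OF has_derivative_add[OF assms[unfolded frechet_derivative_works]]]
  by (simp add: partial_def)

lemma partial_diff:
  assumes "f differentiable (at x)" "h differentiable (at x)"
  shows "partial i (\<lambda>x. f x - h x) x = partial i f x - partial i h x"
  using partial_eq[OF has_derivative_diff[OF assms[unfolded frechet_derivative_works]]]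
  by (simp add: partial_def)

lemma partial_sum:
  assumes "\<And>a. a \<in> S \<Longrightarrow> f a differentiable (at x)"
  shows "partial i (\<lambda>x. \<Sum>a\<in>S. f a x) x = (\<Sum>a\<in>S. partial i (f a) x)"
proof -
  have "((\<lambda>x. \<Sum>a\<in>S. f a x) has_derivative (\<lambda>h. \<Sum>a\<in>S. frechet_derivative (f a) (at x) h)) (at x)"
    using assms by (intro has_derivative_sum) (simp add: frechet_derivative_works[symmetric])
  from partial_eq[OF this] show ?thesis
    by (simp add: partial_def)
qed

lemma partial_prod:
  fixes f :: "'i \<Rightarrow> real^2 \<Rightarrow> 'b::real_normed_field"
  assumes "\<And>a. a \<in> S \<Longrightarrow> f a differentiable (at x)"
  shows "partial i (\<lambda>x. \<Prod>a\<in>S. f a x) x = (\<Sum>a\<in>S. partial i (f a) x * (\<Prod>b\<in>S - {a}. f b x))"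
proof -
  have "((\<lambda>x. \<Prod>a\<in>S. f a x) has_derivative
      (\<lambda>h. \<Sum>a\<in>S. frechet_derivative (f a) (at x) h * (\<Prod>b\<in>S - {a}. f b x))) (at x)"
    using assms by (intro has_derivative_prod) (simp add: frechet_derivative_works[symmetric])
  from partial_eq[OF this] show ?thesis
    by (simp add: partial_def)
qed

text \<open>Derivative rules identify \<open>partial i f\<close> with a formula only on
  \<open>U\<close>, so the inductions on \<open>n\<close> below must exchange functions that agree
  there; openness keeps this stable under further differentiation.\<close>

lemma Ck_on_cong:
  assumes "open U" "\<And>x. x \<in> U \<Longrightarrow> f x = g x"
  shows "Ck_on n U f \<longleftrightarrow> Ck_on n U g"
  using assms(2)
proof (induction n arbitrary: f g)
  case 0
  then show ?case by (simp cong: continuous_on_cong)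
next
  case (Suc n)
  have "Ck_on n U (partial i f) \<longleftrightarrow> Ck_on n U (partial i g)" for i
    by (intro Suc.IH partial_cong[OF assms(1)] Suc.prems)
  then show ?case
    using Suc.prems differentiable_cong_open[OF assms(1), of _ f g] by auto
qed

lemma Ck_on_SucD: "Ck_on (Suc n) U f \<Longrightarrow> Ck_on n U f"
proof (induction n arbitrary: f)
  case 0
  then show ?case
    by (auto intro!: continuous_at_imp_continuous_on differentiable_imp_continuous_within)
next
  case (Suc n)
  then show ?case by (metis Ck_on.simps(2))
qed

text \<open>On an open neighbourhood, continuity is continuity at each point. This reduces
  smoothness of a section defined by choices to neighbourhoods where it has an explicit
  formula.\<close>

lemma Ck_on_local:
  assumes "\<And>x. x \<in> U \<Longrightarrow> \<exists>N. open N \<and> x \<in> N \<and> Ck_on n N f"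
  shows "Ck_on n U f"
  using assms
proof (induction n arbitrary: f)
  case 0
  show ?case
    using 0 by (auto intro!: continuous_at_imp_continuous_on simp: continuous_on_eq_continuous_at)
       (metis continuous_on_eq_continuous_at)
next
  case (Suc n)
  then show ?case by (metis Ck_on.simps(2))
qed

lemma Ck_on_subset: "Ck_on n U f \<Longrightarrow> N \<subseteq> U \<Longrightarrow> Ck_on n N f"
  by (induction n arbitrary: f) (auto intro: continuous_on_subset)

lemma Ck_on_const: "Ck_on n U (\<lambda>_. c)"
proof (induction n arbitrary: c)
  case (Suc n)
  have "partial i (\<lambda>_. c) = (\<lambda>_. 0)" for i by auto
  with Suc show ?case by simp
qed simp

lemma Ck_on_add:
  assumes "open U"
  shows "Ck_on n U f \<Longrightarrow> Ck_on n U g \<Longrightarrow> Ck_on n U (\<lambda>x. f x + g x)"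
proof (induction n arbitrary: f g)
  case (Suc n)
  have "Ck_on n U (partial i (\<lambda>x. f x + g x)) \<longleftrightarrow> Ck_on n U (\<lambda>x. partial i f x + partial i g x)" for i
    using Suc.prems by (intro Ck_on_cong assms partial_add) auto
  with Suc show ?case by auto
qed (auto intro: continuous_intros)

lemma Ck_on_linear:
  assumes "open U" "bounded_linear L"
  shows "Ck_on n U f \<Longrightarrow> Ck_on n U (\<lambda>x. L (f x))"
proof (induction n arbitrary: f)
  case 0
  then show ?case
    by (simp add: bounded_linear.continuous_on[OF assms(2)])
next
  case (Suc n)
  have "Ck_on n U (partial i (\<lambda>x. L (f x))) \<longleftrightarrow> Ck_on n U (\<lambda>x. L (partial i f x))" for i
    using Suc.prems by (intro Ck_on_cong partial_linear assms) auto
  with Suc show ?case by (auto intro: differentiable_linear assms)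
qed

text \<open>The product rule calls the induction hypothesis for \<open>f\<close> with a derivative
  of \<open>g\<close> and conversely, so the undifferentiated factor is first lowered by one order
  with \<open>Ck_on_SucD\<close>.\<close>

lemma Ck_on_bilinear:
  assumes "open U" "bounded_bilinear m"
  shows "Ck_on n U f \<Longrightarrow> Ck_on n U g \<Longrightarrow> Ck_on n U (\<lambda>x. m (f x) (g x))"
proof (induction n arbitrary: f g)
  case 0
  then show ?case
    by (simp add: bounded_bilinear.continuous_on[OF assms(2)])
next
  case (Suc n)
  have "Ck_on n U (partial i (\<lambda>x. m (f x) (g x))) \<longleftrightarrow>
      Ck_on n U (\<lambda>x. m (f x) (partial i g x) + m (partial i f x) (g x))" for i
    using Suc.prems by (intro Ck_on_cong partial_bilinear assms) auto
  then show ?case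
    using Suc.IH Suc.prems Ck_on_SucD[OF Suc.prems(1)] Ck_on_SucD[OF Suc.prems(2)]
    by (auto intro: differentiable_bilinear assms Ck_on_add)
qed

text \<open>The derivative contains 1/f again; written as a product with two copies of 1/f, it
  receives them from the induction hypothesis for the same \<open>f\<close>.\<close>

lemma Ck_on_inverse:
  fixes f :: "real^2 \<Rightarrow> real"
  assumes "open U" "\<And>x. x \<in> U \<Longrightarrow> f x \<noteq> 0"
  shows "Ck_on n U f \<Longrightarrow> Ck_on n U (\<lambda>x. inverse (f x))"
proof (induction n)
  case (Suc n)
  have "partial i (\<lambda>x. inverse (f x)) x = - (inverse (f x) * partial i f x * inverse (f x))"
    if "x \<in> U" for x i
    using partial_eq[OF Deriv.has_derivative_inverse[where f = f and x = x, OF assms(2)[OF that],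
          of "frechet_derivative f (at x)" UNIV]]
      Suc.prems that
    by (simp add: partial_def frechet_derivative_works[symmetric])
  then have *: "Ck_on n U (partial i (\<lambda>x. inverse (f x))) \<longleftrightarrow>
      Ck_on n U (\<lambda>x. - (inverse (f x) * partial i f x * inverse (f x)))" for i
    by (intro Ck_on_cong assms) auto
  have "Ck_on n U (\<lambda>x. - (inverse (f x) * partial i f x * inverse (f x)))" for i
    using Suc Ck_on_SucD[OF Suc.prems]
    by (intro Ck_on_linear[OF assms(1) bounded_linear_minus[OF bounded_linear_ident]]
        Ck_on_bilinear[OF assms(1) bounded_bilinear_mult]) auto
  with * Suc.prems assms show ?case by auto
qed (use assms in \<open>auto intro!: continuous_on_inverse\<close>)

text \<open>The derivative f'/(2 sqrt f) again contains the function itself, so the induction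
  hypothesis and \<open>Ck_on_inverse\<close> supply its order.\<close>

lemma Ck_on_sqrt:
  fixes f :: "real^2 \<Rightarrow> real"
  assumes "open U" "\<And>x. x \<in> U \<Longrightarrow> f x > 0"
  shows "Ck_on n U f \<Longrightarrow> Ck_on n U (\<lambda>x. sqrt (f x))"
proof (induction n)
  case (Suc n)
  have D: "((\<lambda>x. sqrt (f x)) has_derivative
      (\<lambda>h. (inverse (sqrt (f x)) / 2) * frechet_derivative f (at x) h)) (at x)" if "x \<in> U" for x
    using DERIV_real_sqrt[OF assms(2)[OF that]] Suc.prems that
    by (auto intro!: DERIV_compose_FDERIV simp: frechet_derivative_works[symmetric] mult.commute
        dest: DERIV_compose_FDERIV[where g = f and g' = "frechet_derivative f (at x)" and s = UNIV and x = x])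
  then have "partial i (\<lambda>x. sqrt (f x)) x = inverse (sqrt (f x)) * partial i f x * (1 / 2)"
    if "x \<in> U" for x i
    using partial_eq[OF D[OF that]] by (simp add: partial_def)
  then have *: "Ck_on n U (partial i (\<lambda>x. sqrt (f x))) \<longleftrightarrow>
      Ck_on n U (\<lambda>x. inverse (sqrt (f x)) * partial i f x * (1 / 2))" for i
    by (intro Ck_on_cong assms) auto
  have "Ck_on n U (\<lambda>x. inverse (sqrt (f x)) * partial i f x * (1 / 2))" for i
    using Suc Ck_on_SucD[OF Suc.prems] assms(2)
    by (intro Ck_on_bilinear[OF assms(1) bounded_bilinear_mult] Ck_on_inverse Ck_on_const assms(1)) force+
  with * D show ?case by (auto simp: differentiable_def)
qed (auto intro: continuous_intros assms)

lemma smooth_onD: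
  assumes "smooth_on U f"
  shows smooth_on_differentiable: "x \<in> U \<Longrightarrow> f differentiable (at x)"
    and smooth_on_partial: "smooth_on U (partial i f)"
    and smooth_on_continuous: "continuous_on U f"
  using assms unfolding smooth_on_def by (metis Ck_on.simps(2), metis Ck_on.simps(2), metis Ck_on.simps(1))

lemma smooth_on_cong:
  assumes "open U" "\<And>x. x \<in> U \<Longrightarrow> f x = g x"
  shows "smooth_on U f \<longleftrightarrow> smooth_on U g"
  unfolding smooth_on_def using Ck_on_cong[OF assms(1), of f g] assms(2) by blast

lemma smooth_on_local:
  assumes "\<And>x. x \<in> U \<Longrightarrow> \<exists>N. open N \<and> x \<in> N \<and> smooth_on N f"
  shows "smooth_on U f"
  unfolding smooth_on_def using assms by (intro allI Ck_on_local) (metis smooth_on_def)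

lemma smooth_on_subset: "smooth_on U f \<Longrightarrow> N \<subseteq> U \<Longrightarrow> smooth_on N f"
  unfolding smooth_on_def using Ck_on_subset by blast

lemma smooth_on_const [intro, simp]: "smooth_on U (\<lambda>_. c)"
  by (simp add: smooth_on_def Ck_on_const)

lemma smooth_on_linear:
  assumes "open U" "bounded_linear L" "smooth_on U f"
  shows "smooth_on U (\<lambda>x. L (f x))"
  using assms Ck_on_linear unfolding smooth_on_def by blast

lemma smooth_on_add:
  "open U \<Longrightarrow> smooth_on U f \<Longrightarrow> smooth_on U g \<Longrightarrow> smooth_on U (\<lambda>x. f x + g x)"
  unfolding smooth_on_def using Ck_on_add by blast

lemma smooth_on_mult:
  fixes f g :: "real^2 \<Rightarrow> 'b::real_normed_algebra"
  shows "open U \<Longrightarrow> smooth_on U f \<Longrightarrow> smooth_on U g \<Longrightarrow> smooth_on U (\<lambda>x. f x * g x)"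
  unfolding smooth_on_def using Ck_on_bilinear[OF _ bounded_bilinear_mult] by blast

lemma smooth_on_minus: "open U \<Longrightarrow> smooth_on U f \<Longrightarrow> smooth_on U (\<lambda>x. - f x)"
  by (rule smooth_on_linear[OF _ bounded_linear_minus[OF bounded_linear_ident]])

lemma smooth_on_diff:
  "open U \<Longrightarrow> smooth_on U f \<Longrightarrow> smooth_on U g \<Longrightarrow> smooth_on U (\<lambda>x. f x - g x)"
  using smooth_on_add[OF _ _ smooth_on_minus, of U f g] by simp

lemma smooth_on_of_real: "open U \<Longrightarrow> smooth_on U f \<Longrightarrow> smooth_on U (\<lambda>x. of_real (f x))"
  by (rule smooth_on_linear[OF _ bounded_linear_of_real])

lemma smooth_on_inverse:
  fixes f :: "real^2 \<Rightarrow> real"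
  shows "open U \<Longrightarrow> (\<And>x. x \<in> U \<Longrightarrow> f x \<noteq> 0) \<Longrightarrow> smooth_on U f \<Longrightarrow> smooth_on U (\<lambda>x. inverse (f x))"
  unfolding smooth_on_def using Ck_on_inverse by blast

lemma smooth_on_divide:
  fixes f g :: "real^2 \<Rightarrow> real"
  shows "open U \<Longrightarrow> (\<And>x. x \<in> U \<Longrightarrow> g x \<noteq> 0) \<Longrightarrow> smooth_on U f \<Longrightarrow> smooth_on U g \<Longrightarrow>
    smooth_on U (\<lambda>x. f x / g x)"
  unfolding divide_inverse by (intro smooth_on_mult smooth_on_inverse)

lemma smooth_on_sqrt:
  fixes f :: "real^2 \<Rightarrow> real"
  shows "open U \<Longrightarrow> (\<And>x. x \<in> U \<Longrightarrow> f x > 0) \<Longrightarrow> smooth_on U f \<Longrightarrow> smooth_on U (\<lambda>x. sqrt (f x))"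
  unfolding smooth_on_def using Ck_on_sqrt by blast

lemma smooth_on_sum:
  assumes "open U" "\<And>a. a \<in> S \<Longrightarrow> smooth_on U (f a)"
  shows "smooth_on U (\<lambda>x. \<Sum>a\<in>S. f a x)"
  using assms(2) by (induction S rule: infinite_finite_induct) (auto intro: smooth_on_add assms(1))

lemma smooth_on_prod:
  fixes f :: "'i \<Rightarrow> real^2 \<Rightarrow> 'b::{real_normed_algebra,comm_ring_1}"
  assumes "open U" "\<And>a. a \<in> S \<Longrightarrow> smooth_on U (f a)"
  shows "smooth_on U (\<lambda>x. \<Prod>a\<in>S. f a x)"
  using assms(2) by (induction S rule: infinite_finite_induct) (auto intro: smooth_on_mult assms(1))

lemmas smooth_on_intros =
  smooth_on_add smooth_on_mult smooth_on_minus smooth_on_diff smooth_on_of_real smooth_on_inverse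
  smooth_on_divide smooth_on_sqrt smooth_on_sum smooth_on_prod smooth_on_const smooth_on_partial

section \<open>Symmetry of mixed partial derivatives\<close>

lemma line_has_field_derivative:
  fixes f :: "real^2 \<Rightarrow> real"
  assumes "f differentiable (at (y + s *\<^sub>R axis i 1))"
  shows "((\<lambda>s. f (y + s *\<^sub>R axis i 1)) has_field_derivative partial i f (y + s *\<^sub>R axis i 1)) (at s)"
proof -
  let ?D = "frechet_derivative f (at (y + s *\<^sub>R axis i 1))"
  have D: "(f has_derivative ?D) (at (y + s *\<^sub>R axis i 1))"
    using assms by (simp add: frechet_derivative_works)
  have "((\<lambda>s. y + s *\<^sub>R axis i 1) has_derivative (\<lambda>h. h *\<^sub>R axis i 1)) (at s)"
    by (auto intro!: derivative_eq_intros)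
  from has_derivative_compose[OF this D]
  have "((\<lambda>s. f (y + s *\<^sub>R axis i 1)) has_derivative (\<lambda>h. ?D (h *\<^sub>R axis i 1))) (at s)" .
  then show ?thesis
    by (simp add: has_field_derivative_def partial_def linear_scale[OF has_derivative_linear[OF D]] mult_commute_abs)
qed

text \<open>Two uses of the mean value theorem: in direction \<open>i\<close> for the difference of
  \<open>f\<close> across the edge in direction \<open>j\<close>, then in direction \<open>j\<close>
  for \<open>partial i f\<close>. The second difference on the left is symmetric in \<open>i\<close>
  and \<open>j\<close>, which is what makes it useful.\<close>

lemma mixed_difference_mean_value:
  fixes f :: "real^2 \<Rightarrow> real"
  assumes "smooth_on U f" "ball x r \<subseteq> U" "0 < d" "2 * d < r"
  shows "\<exists>z. dist x z < 2 * d \<and>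
    f (x + d *\<^sub>R axis i 1 + d *\<^sub>R axis j 1) - f (x + d *\<^sub>R axis i 1) - f (x + d *\<^sub>R axis j 1) + f x
      = d\<^sup>2 * partial j (partial i f) z"
proof -
  have near: "dist x (x + s *\<^sub>R axis i 1 + t *\<^sub>R axis j 1) < r"
    if "0 \<le> s" "s \<le> d" "0 \<le> t" "t \<le> d" for s t
  proof -
    have "norm (s *\<^sub>R axis i 1 + t *\<^sub>R axis j (1::real)) \<le> s + t"
      using that norm_triangle_ineq[of "s *\<^sub>R axis i (1::real)" "t *\<^sub>R axis j 1"] by (simp add: norm_axis_1)
    then show ?thesis
      using that assms by (simp add: dist_norm norm_minus_commute algebra_simps)
  qed
  then have inU: "x + s *\<^sub>R axis i 1 + t *\<^sub>R axis j 1 \<in> U"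
    if "0 \<le> s" "s \<le> d" "0 \<le> t" "t \<le> d" for s t
    using that assms(2) by auto
  define \<phi> where "\<phi> s = f ((x + d *\<^sub>R axis j 1) + s *\<^sub>R axis i 1) - f (x + s *\<^sub>R axis i 1)" for s
  define \<phi>' where "\<phi>' s = partial i f ((x + d *\<^sub>R axis j 1) + s *\<^sub>R axis i 1) - partial i f (x + s *\<^sub>R axis i 1)" for s
  have "(\<phi> has_field_derivative \<phi>' s) (at s)" if "0 \<le> s" "s \<le> d" for s
  proof -
    have 1: "(x + d *\<^sub>R axis j 1) + s *\<^sub>R axis i 1 \<in> U"
      using inU[OF that, of d] assms(3) by (simp add: add_ac)
    have 2: "x + s *\<^sub>R axis i 1 \<in> U"
      using inU[OF that, of 0] assms(3) by simp
    show ?thesis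
      unfolding \<phi>_def \<phi>'_def
      by (intro DERIV_diff line_has_field_derivative smooth_on_differentiable[OF assms(1) 1]
          smooth_on_differentiable[OF assms(1) 2])
  qed
  then obtain \<xi> where \<xi>: "0 < \<xi>" "\<xi> < d" "\<phi> d - \<phi> 0 = (d - 0) * \<phi>' \<xi>"
    using MVT2[OF assms(3), of \<phi> \<phi>'] by blast
  define \<psi> where "\<psi> t = partial i f ((x + \<xi> *\<^sub>R axis i 1) + t *\<^sub>R axis j 1)" for t
  have "(\<psi> has_field_derivative partial j (partial i f) ((x + \<xi> *\<^sub>R axis i 1) + t *\<^sub>R axis j 1)) (at t)"
    if "0 \<le> t" "t \<le> d" for t
    unfolding \<psi>_def using inU[of \<xi> t] \<xi>(1,2) that
    by (intro line_has_field_derivative smooth_on_differentiable[OF smooth_on_partial[OF assms(1)]]) simp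
  then obtain \<eta> where \<eta>: "0 < \<eta>" "\<eta> < d"
    "\<psi> d - \<psi> 0 = (d - 0) * partial j (partial i f) ((x + \<xi> *\<^sub>R axis i 1) + \<eta> *\<^sub>R axis j 1)"
    using MVT2[OF assms(3), of \<psi> "\<lambda>t. partial j (partial i f) ((x + \<xi> *\<^sub>R axis i 1) + t *\<^sub>R axis j 1)"]
    by blast
  let ?z = "x + \<xi> *\<^sub>R axis i 1 + \<eta> *\<^sub>R axis j 1"
  have "\<psi> d - \<psi> 0 = \<phi>' \<xi>"
    by (simp add: \<psi>_def \<phi>'_def add_ac)
  then have "\<phi> d - \<phi> 0 = d\<^sup>2 * partial j (partial i f) ?z"
    using \<xi>(3) \<eta>(3) by (simp add: power2_eq_square)
  moreover have "norm (\<xi> *\<^sub>R axis i 1 + \<eta> *\<^sub>R axis j (1::real)) \<le> \<xi> + \<eta>"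
    using \<xi> \<eta> norm_triangle_ineq[of "\<xi> *\<^sub>R axis i (1::real)" "\<eta> *\<^sub>R axis j 1"] by (simp add: norm_axis_1)
  then have "dist x ?z < 2 * d"
    using \<xi> \<eta> norm_minus_cancel[of "\<xi> *\<^sub>R axis i 1 + \<eta> *\<^sub>R axis j (1::real)"]
    by (simp add: dist_norm algebra_simps)
  ultimately show ?thesis
    by (intro exI[of _ ?z]) (simp add: \<phi>_def add_ac)
qed

text \<open>If the two mixed partials differed at \<open>x\<close>, continuity would keep their
  values at nearby points apart; but the same second difference, divided by the squared side, is a
  value of each of them near \<open>x\<close>.\<close>

lemma partial_commute_real:
  fixes f :: "real^2 \<Rightarrow> real"
  assumes "open U" "smooth_on U f" "x \<in> U"
  shows "partial i (partial j f) x = partial j (partial i f) x"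
proof (rule ccontr)
  define a b where "a = partial i (partial j f)" and "b = partial j (partial i f)"
  assume "partial i (partial j f) x \<noteq> partial j (partial i f) x"
  then have e: "dist (a x) (b x) / 2 > 0" by (simp add: a_def b_def)
  have "continuous (at x) a" "continuous (at x) b"
    using assms continuous_on_eq_continuous_at smooth_on_continuous smooth_on_partial
    unfolding a_def b_def by metis+
  then obtain r1 r2 where r1: "r1 > 0" "\<And>z. dist z x < r1 \<Longrightarrow> dist (a z) (a x) < dist (a x) (b x) / 2"
    and r2: "r2 > 0" "\<And>z. dist z x < r2 \<Longrightarrow> dist (b z) (b x) < dist (a x) (b x) / 2"
    using e unfolding continuous_at_eps_delta by metis
  obtain r where r: "r > 0" "ball x r \<subseteq> U"
    using assms openE by blast
  \<comment> \<open>A third of the least radius, because the mean value points lie within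
    \<open>2 * d\<close> of \<open>x\<close>.\<close>
  define d where "d = min r (min r1 r2) / 3"
  have d: "d > 0" "2 * d < r" "2 * d < r1" "2 * d < r2"
    using r r1 r2 by (auto simp: d_def)
  obtain z where z: "dist x z < 2 * d" and
    Z: "f (x + d *\<^sub>R axis j 1 + d *\<^sub>R axis i 1) - f (x + d *\<^sub>R axis j 1) - f (x + d *\<^sub>R axis i 1) + f x = d\<^sup>2 * a z"
    unfolding a_def using mixed_difference_mean_value[OF assms(2) r(2) d(1,2)] by blast
  obtain w where w: "dist x w < 2 * d" and
    W: "f (x + d *\<^sub>R axis i 1 + d *\<^sub>R axis j 1) - f (x + d *\<^sub>R axis i 1) - f (x + d *\<^sub>R axis j 1) + f x = d\<^sup>2 * b w"
    unfolding b_def using mixed_difference_mean_value[OF assms(2) r(2) d(1,2)] by blast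
  have "d\<^sup>2 * a z = d\<^sup>2 * b w"
    using Z W by (simp add: algebra_simps)
  then have "a z = b w" using d by simp
  moreover have "dist (a z) (a x) < dist (a x) (b x) / 2" "dist (b w) (b x) < dist (a x) (b x) / 2"
    using r1(2)[of z] r2(2)[of w] z w d by (simp_all add: dist_commute)
  ultimately show False
    using dist_triangle[of "a x" "b x" "a z"] by (simp add: dist_commute)
qed

lemma partial_commute:
  fixes f :: "real^2 \<Rightarrow> complex"
  assumes "open U" "smooth_on U f" "x \<in> U"
  shows "partial i (partial j f) x = partial j (partial i f) x"
proof -
  have *: "partial i (partial j (\<lambda>x. L (f x))) x = L (partial i (partial j f) x)"
    if L: "bounded_linear L" for i j and L :: "complex \<Rightarrow> real"
  proof -
    have "partial i (partial j (\<lambda>x. L (f x))) x = partial i (\<lambda>x. L (partial j f x)) x"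
      by (intro partial_cong[OF assms(1,3)] partial_linear L smooth_on_differentiable[OF assms(2)])
    also have "\<dots> = L (partial i (partial j f) x)"
      by (intro partial_linear L smooth_on_differentiable[OF smooth_on_partial[OF assms(2)]] assms)
    finally show ?thesis .
  qed
  have "L (partial i (partial j f) x) = L (partial j (partial i f) x)"
    if L: "bounded_linear L" for L :: "complex \<Rightarrow> real"
    using partial_commute_real[OF assms(1) smooth_on_linear[OF assms(1) L assms(2)] assms(3)] *[OF L] by metis
  then show ?thesis
    using bounded_linear_Re bounded_linear_Im by (simp add: complex_eq_iff)
qed

lemma partial_zero_imp_constant:
  fixes f :: "real^2 \<Rightarrow> complex"
  assumes "open U" "connected U" "smooth_on U f" "\<And>x i. x \<in> U \<Longrightarrow> partial i f x = 0" "x \<in> U" "y \<in> U"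
  shows "f x = f y"
proof (rule has_derivative_zero_unique_strong_connected[of U "{}" f y])
  show "(f has_derivative (\<lambda>h. 0)) (at z within U)" if "z \<in> U - {}" for z
    using has_derivative_partial[OF smooth_on_differentiable[OF assms(3), of z]] assms(4) that
    by (simp add: has_derivative_at_withinI)
qed (use assms smooth_on_continuous in auto)


section \<open>Sums over words and signs\<close>

lemma UNIV_sign: "UNIV = {Plus, Minus}"
  using sign.exhaust by auto

instance sign :: finite
  by intro_classes (simp add: UNIV_sign)

lemma sum_sign: "(\<Sum>s\<in>UNIV. f s) = f Plus + f Minus"
  by (simp add: UNIV_sign)

lemma finite_words [simp]: "finite {w :: 'b::finite list. length w = k}"
  using finite_lists_length_eq[of "UNIV :: 'b set" k] by simp

text \<open>The generalised distributive law, by splitting off the first letter. It turns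
  contractions over multi-indices into products of contractions in the separate tensor
  factors.\<close>

lemma sum_words_prod:
  fixes f :: "nat \<Rightarrow> 'b::finite \<Rightarrow> 'c::comm_semiring_1"
  shows "(\<Sum>w | length w = k. \<Prod>j<k. f j (w ! j)) = (\<Prod>j<k. \<Sum>a\<in>UNIV. f j a)"
proof (induction k arbitrary: f)
  case (Suc k)
  have *: "{w :: 'b list. length w = Suc k} = (\<lambda>(a, w). a # w) ` (UNIV \<times> {w. length w = k})"
    by (auto simp: length_Suc_conv image_iff)
  have "(\<Sum>w | length w = Suc k. \<Prod>j<Suc k. f j (w ! j)) =
      (\<Sum>(a, w)\<in>UNIV \<times> {w. length w = k}. f 0 a * (\<Prod>j<k. f (Suc j) (w ! j)))"
    unfolding * by (subst sum.reindex) (auto simp: inj_on_def prod.lessThan_Suc_shift intro!: sum.cong simp del: prod.lessThan_Suc)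
  also have "\<dots> = (\<Sum>a\<in>UNIV. f 0 a) * (\<Sum>w | length w = k. \<Prod>j<k. f (Suc j) (w ! j))"
    by (simp add: sum_product sum.cartesian_product)
  also have "\<dots> = (\<Prod>j<Suc k. \<Sum>a\<in>UNIV. f j a)"
    unfolding Suc.IH[of "\<lambda>j. f (Suc j)"] by (simp add: prod.lessThan_Suc_shift del: prod.lessThan_Suc)
  finally show ?case .
qed simp

lemma prod_delta_words:
  assumes "length w = k" "length u = k"
  shows "(\<Prod>j<k. if w ! j = u ! j then 1 else 0 :: 'c::comm_semiring_1) = (if w = u then 1 else 0)"
proof (cases "w = u")
  case False
  then obtain j where "j < k" "w ! j \<noteq> u ! j"
    using assms nth_equalityI by metis
  then have "(\<Prod>j<k. if w ! j = u ! j then 1 else 0 :: 'c) = 0"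
    by (intro prod_zero) auto
  with False show ?thesis by simp
qed simp

primrec sgn_of :: "sign \<Rightarrow> real" where
  "sgn_of Plus = 1"
| "sgn_of Minus = -1"

text \<open>The number n of the overview, in the form in which the Leibniz rule produces it.\<close>

definition weight :: "sign list \<Rightarrow> real" where
  "weight I = (\<Sum>m<length I. sgn_of (I ! m))"

lemma weight_eq: "weight I = real (count_list I Plus) - real (count_list I Minus)"
proof (induction I)
  case (Cons s I)
  then show ?case
    by (cases s) (simp_all add: weight_def sum.lessThan_Suc_shift del: sum.lessThan_Suc)
qed (simp add: weight_def)

lemma balanced_words_iff: "I \<in> balanced_words k \<longleftrightarrow> length I = k \<and> weight I = 0"
  by (auto simp: balanced_words_def weight_eq)

text \<open>Equally many factors \<open>z Plus\<close> and \<open>z Minus\<close> pair off to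
  1.\<close>

lemma prod_phase_balanced:
  assumes "I \<in> balanced_words k" "z Plus * z Minus = (1::complex)"
  shows "(\<Prod>m<k. z (I ! m)) = 1"
proof -
  have "(\<Prod>m<length I. z (I ! m)) = z Plus ^ count_list I Plus * z Minus ^ count_list I Minus" for I
  proof (induction I)
    case (Cons s I)
    then show ?case
      by (cases s) (simp_all add: prod.lessThan_Suc_shift algebra_simps del: prod.lessThan_Suc)
  qed simp
  from this[of I] show ?thesis
    using assms by (simp add: balanced_words_def flip: power_mult_distrib)
qed


section \<open>Orthonormal frames of an inner product on the plane\<close>

definition orthonormal_pair :: "real^2^2 \<Rightarrow> real^2 \<Rightarrow> real^2 \<Rightarrow> bool" where
  "orthonormal_pair G u v \<longleftrightarrow> u \<bullet> (G *v u) = 1 \<and> v \<bullet> (G *v v) = 1 \<and> u \<bullet> (G *v v) = 0"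

definition det2 :: "real^2 \<Rightarrow> real^2 \<Rightarrow> real" where
  "det2 u v = u $ 1 * v $ 2 - u $ 2 * v $ 1"

lemma det2_matrix: "det2 (J *v u) (J *v v) = det J * det2 u v"
  by (simp add: det2_def det_2 matrix_vector_mult_def sum_2 algebra_simps)

lemma inner_matrix_sum: "u \<bullet> ((G :: real^2^2) *v v) = (\<Sum>a\<in>UNIV. \<Sum>b\<in>UNIV. G $ a $ b * u $ a * v $ b)"
  by (simp add: inner_vec_def matrix_vector_mult_def sum_2 algebra_simps)

lemma inner_matrix_sym:
  assumes "transpose G = (G :: real^2^2)"
  shows "u \<bullet> (G *v v) = v \<bullet> (G *v u)"
  by (metis assms dot_lmul_matrix inner_commute vector_transpose_matrix)

text \<open>For the matrix R with rows u and v, orthonormality says R G R^T = 1; for square matrices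
  this also gives R^T R G = 1, which applied to \<open>w\<close> is the expansion.\<close>

lemma orthonormal_expand:
  fixes G :: "real^2^2"
  assumes "transpose G = G" "orthonormal_pair G u v"
  shows "w = (u \<bullet> (G *v w)) *\<^sub>R u + (v \<bullet> (G *v w)) *\<^sub>R v"
proof -
  define R :: "real^2^2" where "R = vector [u, v]"
  have R: "R $ 1 = u" "R $ 2 = v" by (simp_all add: R_def)
  have vu: "v \<bullet> (G *v u) = 0"
    using assms inner_matrix_sym orthonormal_pair_def by metis
  have "((R ** G) ** transpose R) $ i $ j = R $ i \<bullet> (G *v R $ j)" for i j
    by (simp add: matrix_matrix_mult_def transpose_def inner_matrix_sum sum_2 algebra_simps)
  then have "(R ** G) ** transpose R = mat 1"
    using assms(2) vu by (simp add: vec_eq_iff forall_2 R mat_def orthonormal_pair_def)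
  then have "transpose R ** (R ** G) = mat 1"
    by (simp add: matrix_left_right_inverse)
  then have "w = transpose R *v (R *v (G *v w))"
    by (metis matrix_vector_mul_assoc matrix_vector_mul_lid)
  then show ?thesis
    by (simp add: vec_eq_iff matrix_vector_mult_def transpose_def sum_2 R forall_2 inner_vec_def algebra_simps)
qed

definition hcomp :: "sign \<Rightarrow> real^2 \<Rightarrow> real^2 \<Rightarrow> 2 \<Rightarrow> complex" where
  "hcomp s u v i = complex_of_real (u $ i) - complex_of_real (sgn_of s) * \<i> * complex_of_real (v $ i)"

lemma h_vec_eq_hcomp: "h_vec X Y s c $ i = hcomp s (X c) (Y c) i"
  by (cases s) (simp_all add: hcomp_def)

lemma orthonormal_pair_det2:
  assumes "orthonormal_pair G u v"
  shows "det2 u v \<noteq> 0"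
proof
  assume d: "det2 u v = 0"
  \<comment> \<open>A vanishing determinant makes the vectors proportional, explicitly <v,v> u =
    <u,v> v; here <v,v> = 1 and <u,v> = 0.\<close>
  have "u $ 1 * (v \<bullet> (G *v v)) = v $ 1 * (u \<bullet> (G *v v))" "u $ 2 * (v \<bullet> (G *v v)) = v $ 2 * (u \<bullet> (G *v v))"
    using d by (auto simp: det2_def inner_matrix_sum sum_2) algebra+
  then have "u = 0"
    using assms by (simp add: orthonormal_pair_def vec_eq_iff forall_2)
  with assms show False by (simp add: orthonormal_pair_def)
qed

text \<open>Orthonormality and equal orientation force the change of frame to be a rotation, c = -b
  and d = a. Over the complex numbers it is diagonal on h_+ and h_-, with eigenvalues a + \<i> b and
  a - \<i> b.\<close>

lemma orthonormal_rotation: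
  fixes G :: "real^2^2"
  assumes G: "transpose G = G" and uv: "orthonormal_pair G u v" "orthonormal_pair G u' v'"
    and pos: "det2 u v * det2 u' v' > 0"
  obtains z :: "sign \<Rightarrow> complex" where "z Plus * z Minus = 1"
    "\<And>s i. hcomp s u' v' i = z s * hcomp s u v i"
proof -
  define a b c d where "a = u \<bullet> (G *v u')" "b = v \<bullet> (G *v u')" "c = u \<bullet> (G *v v')" "d = v \<bullet> (G *v v')"
  have u': "u' = a *\<^sub>R u + b *\<^sub>R v" and v': "v' = c *\<^sub>R u + d *\<^sub>R v"
    unfolding a_b_c_d_def using orthonormal_expand[OF G uv(1)] by auto
  have vu: "v \<bullet> (G *v u) = 0"
    using uv G inner_matrix_sym orthonormal_pair_def by metis
  have ip: "(p *\<^sub>R u + q *\<^sub>R v) \<bullet> (G *v (r *\<^sub>R u + s *\<^sub>R v)) = p * r + q * s" for p q r s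
    using uv(1) vu
    by (simp add: orthonormal_pair_def inner_add_left inner_add_right matrix_vector_right_distrib
        matrix_vector_mult_scaleR)
  have 1: "a * a + b * b = 1" "c * c + d * d = 1" "a * c + b * d = 0"
    using uv(2) unfolding orthonormal_pair_def u' v' ip by auto
  have "det2 u' v' = (a * d - b * c) * det2 u v"
    by (simp add: u' v' det2_def algebra_simps)
  \<comment> \<open>A second copy of \<open>det2 u v\<close> turns one side into a square times the
    wanted determinant and the other into the product from \<open>pos\<close>.\<close>
  then have "(a * d - b * c) * (det2 u v)\<^sup>2 = det2 u v * det2 u' v'"
    by (simp add: power2_eq_square)
  then have "(a * d - b * c) * (det2 u v)\<^sup>2 > 0"
    using pos by simp
  then have 2: "a * d - b * c > 0"
    by (simp add: zero_less_mult_iff)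
  have "(a * d - b * c)\<^sup>2 = 1"
    using 1 by algebra
  with 2 have 3: "a * d - b * c = 1"
    by (metis abs_of_pos real_sqrt_abs real_sqrt_one)
  have cd: "c = - b" "d = a"
    using 1 3 by algebra+
  define z where "z s = complex_of_real a + complex_of_real (sgn_of s) * \<i> * complex_of_real b" for s
  have "z Plus * z Minus = complex_of_real (a * a + b * b)"
    by (simp add: z_def algebra_simps)
  moreover have "hcomp s u' v' i = z s * hcomp s u v i" for s i
    by (cases s) (simp_all add: hcomp_def z_def u' v' cd algebra_simps)
  ultimately show ?thesis
    using that 1 by simp
qed

text \<open>The dual frame of \<open>h\<^sub>+, h\<^sub>-\<close>: these vectors are isotropic and pair to \<open>2\<close>.\<close>

definition hdual :: "real^2^2 \<Rightarrow> sign \<Rightarrow> real^2 \<Rightarrow> real^2 \<Rightarrow> 2 \<Rightarrow> complex" where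
  "hdual G s u v i = (\<Sum>l\<in>UNIV. complex_of_real (G $ i $ l) *
     (complex_of_real (u $ l) + complex_of_real (sgn_of s) * \<i> * complex_of_real (v $ l))) / 2"

text \<open>Up to the factor 1/2, \<open>hdual G s\<close> is the metric pairing with the field of
  opposite sign. The first relation is duality of the two bases; the second is completeness, namely
  the expansion of a coordinate vector in the frame read in components.\<close>

lemma
  fixes G :: "real^2^2"
  assumes G: "transpose G = G" and uv: "orthonormal_pair G u v"
  shows hdual_hcomp: "(\<Sum>i\<in>UNIV. hdual G s u v i * hcomp t u v i) = (if s = t then 1 else 0)"
    and hcomp_hdual: "(\<Sum>s\<in>UNIV. hdual G s u v i * hcomp s u v j) = (if i = j then 1 else 0)"
proof -
  have vu: "v \<bullet> (G *v u) = 0"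
    using uv G inner_matrix_sym orthonormal_pair_def by metis
  have c: "complex_of_real (u \<bullet> (G *v u)) = 1" "complex_of_real (v \<bullet> (G *v v)) = 1"
      "complex_of_real (u \<bullet> (G *v v)) = 0" "complex_of_real (v \<bullet> (G *v u)) = 0"
    using uv vu by (auto simp: orthonormal_pair_def)
  have s: "G $ 2 $ 1 = G $ 1 $ 2"
    using arg_cong[OF G, of "\<lambda>A. A $ 1 $ 2"] by (simp add: transpose_def)
  have e: "2 * hdual G s u v i = (\<Sum>l\<in>UNIV. complex_of_real (G $ i $ l) *
     (complex_of_real (u $ l) + complex_of_real (sgn_of s) * \<i> * complex_of_real (v $ l)))" for i
    by (simp add: hdual_def)
  have "2 * (\<Sum>i\<in>UNIV. hdual G s u v i * hcomp t u v i) = (\<Sum>i\<in>UNIV. 2 * hdual G s u v i * hcomp t u v i)"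
    by (simp add: sum_distrib_left mult.assoc)
  also have "\<dots> =
     complex_of_real (u \<bullet> (G *v u)) + sgn_of s * sgn_of t * complex_of_real (v \<bullet> (G *v v)) +
     \<i> * (sgn_of s * complex_of_real (u \<bullet> (G *v v)) - sgn_of t * complex_of_real (v \<bullet> (G *v u)))"
    unfolding e by (cases s; cases t) (simp_all add: hcomp_def inner_matrix_sum sum_2 s algebra_simps)
  finally show "(\<Sum>i\<in>UNIV. hdual G s u v i * hcomp t u v i) = (if s = t then 1 else 0)"
    unfolding c by (cases s; cases t) (simp_all add: field_simps)
next
  have e: "axis i 1 = (u \<bullet> (G *v axis i 1)) *\<^sub>R u + (v \<bullet> (G *v axis i 1)) *\<^sub>R v"
    by (rule orthonormal_expand[OF G uv])
  have "(\<Sum>s\<in>UNIV. hdual G s u v i * hcomp s u v j) =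
      complex_of_real (((G *v u) $ i) * u $ j + ((G *v v) $ i) * v $ j)"
    by (simp add: sum_sign hdual_def hcomp_def matrix_vector_mult_def sum_2 field_simps)
  also have "(G *v u) $ i = u \<bullet> (G *v axis i 1)"
    by (metis G inner_axis' inner_matrix_sym real_inner_1_left scaleR_one inner_real_def mult_1)
  also have "(G *v v) $ i = v \<bullet> (G *v axis i 1)"
    by (metis G inner_axis' inner_matrix_sym real_inner_1_left scaleR_one inner_real_def mult_1)
  also have "(u \<bullet> (G *v axis i 1)) * u $ j + (v \<bullet> (G *v axis i 1)) * v $ j = axis i 1 $ j"
    by (subst e) simp
  finally show "(\<Sum>s\<in>UNIV. hdual G s u v i * hcomp s u v j) = (if i = j then 1 else 0)"
    by (simp add: axis_def)
qed

section \<open>Products of frame fields in multi-index components, and their dual family\<close>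

definition hprod :: "sign list \<Rightarrow> real^2 \<Rightarrow> real^2 \<Rightarrow> 2 list \<Rightarrow> complex" where
  "hprod I u v w = (\<Prod>m<length I. hcomp (I ! m) u v (w ! m))"

definition hdprod :: "real^2^2 \<Rightarrow> sign list \<Rightarrow> real^2 \<Rightarrow> real^2 \<Rightarrow> 2 list \<Rightarrow> complex" where
  "hdprod G I u v w = (\<Prod>m<length I. hdual G (I ! m) u v (w ! m))"

text \<open>This relation and the next factor over the tensor slots by
  \<open>sum_words_prod\<close>; in each slot they reduce to completeness and to duality,
  respectively.\<close>

lemma sum_hdprod_hprod_signs:
  assumes "transpose G = G" "orthonormal_pair G u v" "length w = k" "length w' = k"
  shows "(\<Sum>I | length I = k. hdprod G I u v w' * hprod I u v w) = (if w' = w then 1 else 0)"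
proof -
  have "(\<Sum>I | length I = k. hdprod G I u v w' * hprod I u v w) =
      (\<Sum>I | length I = k. \<Prod>m<k. hdual G (I ! m) u v (w' ! m) * hcomp (I ! m) u v (w ! m))"
    by (intro sum.cong) (auto simp: hdprod_def hprod_def prod.distrib)
  also have "\<dots> = (\<Prod>m<k. if w' ! m = w ! m then 1 else 0)"
    using sum_words_prod[of "\<lambda>m s. hdual G s u v (w' ! m) * hcomp s u v (w ! m)" k]
    by (simp add: hcomp_hdual[OF assms(1,2)])
  also have "\<dots> = (if w' = w then 1 else 0)"
    by (rule prod_delta_words[OF assms(4,3)])
  finally show ?thesis .
qed

lemma sum_hdprod_hprod_words:
  assumes "transpose G = G" "orthonormal_pair G u v" "length I = k" "length I' = k"
  shows "(\<Sum>w | length w = k. hdprod G I u v w * hprod I' u v w) = (if I = I' then 1 else 0)"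
proof -
  have "(\<Sum>w | length w = k. hdprod G I u v w * hprod I' u v w) =
      (\<Sum>w | length w = k. \<Prod>m<k. hdual G (I ! m) u v (w ! m) * hcomp (I' ! m) u v (w ! m))"
    using assms by (intro sum.cong) (auto simp: hdprod_def hprod_def prod.distrib)
  also have "\<dots> = (\<Prod>m<k. if I ! m = I' ! m then 1 else 0)"
    using sum_words_prod[of "\<lambda>m i. hdual G (I ! m) u v i * hcomp (I' ! m) u v i" k]
    by (simp add: hdual_hcomp[OF assms(1,2)])
  also have "\<dots> = (if I = I' then 1 else 0)"
    by (rule prod_delta_words[OF assms(3,4)])
  finally show ?thesis .
qed

lemma hprod_expansion:
  assumes "transpose G = G" "orthonormal_pair G u v" "length w = k"
  shows "t w = (\<Sum>I | length I = k. (\<Sum>w' | length w' = k. hdprod G I u v w' * t w') * hprod I u v w)"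
proof -
  have "(\<Sum>I | length I = k. (\<Sum>w' | length w' = k. hdprod G I u v w' * t w') * hprod I u v w) =
      (\<Sum>w' | length w' = k. t w' * (\<Sum>I | length I = k. hdprod G I u v w' * hprod I u v w))"
    unfolding sum_distrib_left sum_distrib_right by (subst sum.swap) (simp add: mult_ac)
  also have "\<dots> = (\<Sum>w' | length w' = k. if w' = w then t w' else 0)"
    using assms by (intro sum.cong) (simp_all add: sum_hdprod_hprod_signs)
  also have "\<dots> = t w"
    using assms by simp
  finally show ?thesis ..
qed

text \<open>Pairing the vanishing combination with the dual product of \<open>I\<close> leaves the
  single coefficient \<open>a I\<close>.\<close>

lemma hprod_independent:
  assumes "transpose G = G" "orthonormal_pair G u v" "S \<subseteq> {I. length I = k}"
    and eq: "\<And>w. length w = k \<Longrightarrow> (\<Sum>I\<in>S. a I * hprod I u v w) = 0"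
    and I: "I \<in> S"
  shows "a I = 0"
proof -
  have len: "length J = k" if "J \<in> S" for J
    using that assms(3) by blast
  have fin: "finite S"
    using assms(3) finite_subset finite_words by blast
  have "0 = (\<Sum>w | length w = k. hdprod G I u v w * (\<Sum>I\<in>S. a I * hprod I u v w))"
    by (simp add: eq)
  also have "\<dots> = (\<Sum>J\<in>S. a J * (\<Sum>w | length w = k. hdprod G I u v w * hprod J u v w))"
    unfolding sum_distrib_left by (subst sum.swap) (simp add: mult_ac)
  also have "\<dots> = (\<Sum>J\<in>S. if I = J then a J else 0)"
    using len I by (intro sum.cong refl) (simp add: sum_hdprod_hprod_words[OF assms(1,2)])
  also have "\<dots> = a I"
    using I fin by simp
  finally show ?thesis ..
qed

text \<open>\<open>matrix_inv\<close> is a choice among two-sided inverses; for a square matrix a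
  one-sided inverse is two-sided and unique.\<close>

lemma matrix_inv_eq:
  fixes A B :: "real^'n^'n"
  assumes "A ** B = mat 1"
  shows "matrix_inv A = B"
  unfolding matrix_inv_def
proof (rule some_equality)
  show "A ** B = mat 1 \<and> B ** A = mat 1"
    using assms matrix_left_right_inverse by blast
  show "C = B" if "A ** C = mat 1 \<and> C ** A = mat 1" for C
    using that assms by (metis matrix_mul_assoc matrix_mul_lid matrix_mul_rid)
qed


section \<open>Local geometry in one chart\<close>

text \<open>The metric in one chart, on an open set of coordinate points and detached from the
  surface, so that the local geometry becomes calculus in the plane.\<close>

locale gram_field =
  fixes g :: "'a metric_tensor" and c :: "'a chart" and N :: "(real^2) set"
  assumes open_N: "open N"
    and smooth_g: "\<And>i j. smooth_on N (\<lambda>x. g c x $ i $ j)"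
    and sym_g: "\<And>x. x \<in> N \<Longrightarrow> transpose (g c x) = g c x"
    and pos_g: "\<And>x v. x \<in> N \<Longrightarrow> v \<noteq> 0 \<Longrightarrow> v \<bullet> (g c x *v v) > 0"
begin

abbreviation "\<Gamma> \<equiv> christoffel g c"

definition gdet :: "real^2 \<Rightarrow> real" where
  "gdet x = g c x $ 1 $ 1 * g c x $ 2 $ 2 - g c x $ 1 $ 2 * g c x $ 1 $ 2"

lemma g_sym: "x \<in> N \<Longrightarrow> g c x $ i $ j = g c x $ j $ i"
  using arg_cong[OF sym_g, of x "\<lambda>A. A $ j $ i"] by (simp add: transpose_def)

lemma g21: "x \<in> N \<Longrightarrow> g c x $ 2 $ 1 = g c x $ 1 $ 2"
  by (rule g_sym)

lemma g11_pos: "x \<in> N \<Longrightarrow> g c x $ 1 $ 1 > 0"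
  using pos_g[of x "vector [1, 0]"] by (simp add: inner_matrix_sum sum_2 vec_eq_iff forall_2)

lemma gdet_pos:
  assumes "x \<in> N"
  shows "gdet x > 0"
proof -
  \<comment> \<open>With entries E, F, G of the Gram matrix, (-F, E) is orthogonal to the first
    coordinate vector and has squared length E (E G - F^2).\<close>
  let ?v = "vector [- g c x $ 1 $ 2, g c x $ 1 $ 1] :: real^2"
  have "?v \<noteq> 0"
    using g11_pos[OF assms] by (simp add: vec_eq_iff forall_2)
  then have "?v \<bullet> (g c x *v ?v) > 0"
    by (rule pos_g[OF assms])
  also have "?v \<bullet> (g c x *v ?v) = g c x $ 1 $ 1 * gdet x"
    by (simp add: inner_matrix_sum sum_2 gdet_def g21[OF assms] algebra_simps)
  finally show ?thesis
    using g11_pos[OF assms] by (simp add: zero_less_mult_iff)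
qed

lemma smooth_gdet: "smooth_on N gdet"
  unfolding gdet_def by (intro smooth_on_intros smooth_g open_N)

lemma matrix_inv_g:
  assumes "x \<in> N"
  shows "g c x ** matrix_inv (g c x) = mat 1"
    and "matrix_inv (g c x) $ 1 $ 1 = g c x $ 2 $ 2 / gdet x"
    and "matrix_inv (g c x) $ 1 $ 2 = - g c x $ 1 $ 2 / gdet x"
    and "matrix_inv (g c x) $ 2 $ 1 = - g c x $ 1 $ 2 / gdet x"
    and "matrix_inv (g c x) $ 2 $ 2 = g c x $ 1 $ 1 / gdet x"
proof -
  let ?B = "vector [vector [g c x $ 2 $ 2 / gdet x, - g c x $ 1 $ 2 / gdet x],
    vector [- g c x $ 1 $ 2 / gdet x, g c x $ 1 $ 1 / gdet x]] :: real^2^2"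
  have "gdet x \<noteq> 0"
    using gdet_pos[OF assms] by simp
  then have B: "g c x ** ?B = mat 1"
    by (simp add: vec_eq_iff forall_2 matrix_matrix_mult_def sum_2 mat_def g21[OF assms] divide_simps)
      (simp add: gdet_def algebra_simps)
  then have "matrix_inv (g c x) = ?B"
    by (rule matrix_inv_eq)
  then show "g c x ** matrix_inv (g c x) = mat 1"
    and "matrix_inv (g c x) $ 1 $ 1 = g c x $ 2 $ 2 / gdet x"
    and "matrix_inv (g c x) $ 1 $ 2 = - g c x $ 1 $ 2 / gdet x"
    and "matrix_inv (g c x) $ 2 $ 1 = - g c x $ 1 $ 2 / gdet x"
    and "matrix_inv (g c x) $ 2 $ 2 = g c x $ 1 $ 1 / gdet x"
    using B by simp_all
qed

lemma smooth_matrix_inv: "smooth_on N (\<lambda>x. matrix_inv (g c x) $ i $ j)"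
proof -
  have *: "smooth_on N (\<lambda>x. g c x $ 2 $ 2 / gdet x)" "smooth_on N (\<lambda>x. - g c x $ 1 $ 2 / gdet x)"
    "smooth_on N (\<lambda>x. g c x $ 1 $ 1 / gdet x)"
    by (intro smooth_on_intros smooth_g smooth_gdet open_N; use gdet_pos in force)+
  note cong = smooth_on_cong[OF open_N, THEN iffD2]
  consider "i = 1" "j = 1" | "i = 1" "j = 2" | "i = 2" "j = 1" | "i = 2" "j = 2"
    using exhaust_2 by metis
  then show ?thesis
    by cases (simp_all only: cong[OF matrix_inv_g(2) *(1)] cong[OF matrix_inv_g(3) *(2)]
        cong[OF matrix_inv_g(4) *(2)] cong[OF matrix_inv_g(5) *(3)])
qed

section \<open>The Levi-Civita connection in coordinates\<close>

lemma smooth_christoffel: "smooth_on N (\<lambda>x. \<Gamma> x i j k)"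
  unfolding christoffel_def
  by (intro smooth_on_intros smooth_matrix_inv smooth_g open_N) simp

text \<open>Contracting with g cancels \<open>matrix_inv\<close> and leaves the Christoffel symbols
  of the first kind.\<close>

lemma lower_christoffel:
  assumes "x \<in> N"
  shows "(\<Sum>i\<in>UNIV. g c x $ a $ i * \<Gamma> x i j k) =
    (partial j (\<lambda>y. g c y $ k $ a) x + partial k (\<lambda>y. g c y $ j $ a) x - partial a (\<lambda>y. g c y $ j $ k) x) / 2"
proof -
  define T where "T l = partial j (\<lambda>y. g c y $ k $ l) x + partial k (\<lambda>y. g c y $ j $ l) x
    - partial l (\<lambda>y. g c y $ j $ k) x" for l
  have inv: "(\<Sum>i\<in>UNIV. g c x $ a $ i * matrix_inv (g c x) $ i $ l) = (if a = l then 1 else 0)" for l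
    using arg_cong[OF matrix_inv_g(1)[OF assms], of "\<lambda>A. A $ a $ l"]
    by (simp add: matrix_matrix_mult_def mat_def)
  have "(\<Sum>i\<in>UNIV. g c x $ a $ i * \<Gamma> x i j k) =
      (\<Sum>i\<in>UNIV. \<Sum>l\<in>UNIV. g c x $ a $ i * matrix_inv (g c x) $ i $ l * T l / 2)"
    by (simp add: christoffel_def T_def sum_distrib_left sum_divide_distrib mult.assoc)
  also have "\<dots> = (\<Sum>l\<in>UNIV. (\<Sum>i\<in>UNIV. g c x $ a $ i * matrix_inv (g c x) $ i $ l) * T l / 2)"
    by (subst sum.swap) (simp add: sum_distrib_right sum_divide_distrib)
  also have "\<dots> = (\<Sum>l\<in>UNIV. if a = l then T l / 2 else 0)"
    unfolding inv by (intro sum.cong) auto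
  also have "\<dots> = T a / 2"
    by simp
  finally show ?thesis
    by (simp add: T_def)
qed

text \<open>This is \<nabla> g = 0: adding two symbols of the first kind with \<open>a\<close> and
  \<open>b\<close> exchanged, all terms but the derivative of g_ab cancel by symmetry of g.\<close>

lemma partial_g:
  assumes "x \<in> N"
  shows "partial j (\<lambda>y. g c y $ a $ b) x =
    (\<Sum>i\<in>UNIV. g c x $ a $ i * \<Gamma> x i j b) + (\<Sum>i\<in>UNIV. g c x $ b $ i * \<Gamma> x i j a)"
proof -
  have s: "partial m (\<lambda>y. g c y $ p $ q) x = partial m (\<lambda>y. g c y $ q $ p) x" for m p q
    by (rule partial_cong[OF open_N assms g_sym])
  show ?thesis
    unfolding lower_christoffel[OF assms] using s[of j a b] s[of a j b] s[of b j a] by (simp add: field_simps)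
qed

definition covd :: "2 \<Rightarrow> (real^2 \<Rightarrow> real^2) \<Rightarrow> real^2 \<Rightarrow> real^2" where
  "covd j X x = (\<chi> i. partial j (\<lambda>y. X y $ i) x + (\<Sum>l\<in>UNIV. \<Gamma> x i j l * X x $ l))"

lemma metric_compatible:
  assumes x: "x \<in> N" and X: "\<And>i. (\<lambda>y. X y $ i) differentiable (at x)"
    and Y: "\<And>i. (\<lambda>y. Y y $ i) differentiable (at x)"
  shows "partial j (\<lambda>y. X y \<bullet> (g c y *v Y y)) x =
    covd j X x \<bullet> (g c x *v Y x) + X x \<bullet> (g c x *v covd j Y x)"
proof -
  have G: "(\<lambda>y. g c y $ a $ b) differentiable (at x)" for a b
    by (rule smooth_on_differentiable[OF smooth_g x])
  have "partial j (\<lambda>y. g c y $ a $ b * X y $ a * Y y $ b) x =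
      partial j (\<lambda>y. g c y $ a $ b) x * X x $ a * Y x $ b + g c x $ a $ b * partial j (\<lambda>y. X y $ a) x * Y x $ b
      + g c x $ a $ b * X x $ a * partial j (\<lambda>y. Y y $ b) x" for a b
    using G X Y by (simp add: partial_mult differentiable_mult algebra_simps)
  then have "partial j (\<lambda>y. X y \<bullet> (g c y *v Y y)) x = (\<Sum>a\<in>UNIV. \<Sum>b\<in>UNIV.
      partial j (\<lambda>y. g c y $ a $ b) x * X x $ a * Y x $ b + g c x $ a $ b * partial j (\<lambda>y. X y $ a) x * Y x $ b
      + g c x $ a $ b * X x $ a * partial j (\<lambda>y. Y y $ b) x)"
    unfolding inner_matrix_sum using G X Y
    by (subst partial_sum; (intro differentiable_sum differentiable_mult ballI)?; simp?)+
  then show ?thesis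
    unfolding partial_g[OF x] inner_matrix_sum covd_def
    by (simp add: sum_2 g21[OF x] algebra_simps)
qed

lemma smooth_covd:
  assumes "\<And>i. smooth_on N (\<lambda>y. X y $ i)"
  shows "smooth_on N (\<lambda>y. covd j X y $ i)"
  unfolding covd_def vec_lambda_beta
  by (intro smooth_on_intros smooth_christoffel assms open_N)

end

text \<open>The sign \<open>\<sigma>\<close> selects the orientation of the Gram--Schmidt frame of the coordinate fields.\<close>

locale gram_frame = gram_field g c N for g :: "'a metric_tensor" and c N +
  fixes \<sigma> :: real
  assumes sigma: "\<sigma> * \<sigma> = 1"
begin

definition fu :: "real^2 \<Rightarrow> real^2" where
  "fu x = vector [1 / sqrt (g c x $ 1 $ 1), 0]"

text \<open>The vector (-F, E) from \<open>gdet_pos\<close>, divided by its length sqrt(E (E G -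
  F^2)) and multiplied by the orientation sign.\<close>

definition fv :: "real^2 \<Rightarrow> real^2" where
  "fv x = vector [- \<sigma> * g c x $ 1 $ 2 / (sqrt (g c x $ 1 $ 1) * sqrt (gdet x)),
     \<sigma> * g c x $ 1 $ 1 / (sqrt (g c x $ 1 $ 1) * sqrt (gdet x))]"

lemma frame_orthonormal:
  assumes "x \<in> N"
  shows "orthonormal_pair (g c x) (fu x) (fv x)"
proof -
  let ?E = "g c x $ 1 $ 1" and ?F = "g c x $ 1 $ 2" and ?G = "g c x $ 2 $ 2" and ?W = "gdet x"
  \<comment> \<open>Naming the roots leaves rational identities in \<open>e\<close> and
    \<open>w\<close>, together with e^2 = E and w^2 = E G - F^2.\<close>
  define e w where "e = sqrt ?E" and "w = sqrt ?W"
  have e: "e \<noteq> 0" "w \<noteq> 0" "?E = e * e" and w: "w * w = e * e * ?G - ?F * ?F"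
    using g11_pos[OF assms] gdet_pos[OF assms] gdet_def[of x] by (auto simp: e_def w_def)
  have "fv x \<bullet> (g c x *v fv x) = (\<sigma> * \<sigma>) * (e * e * ?G - ?F * ?F) / (w * w)"
    using e(1,2) unfolding fv_def inner_matrix_sum sum_2 e_def[symmetric] w_def[symmetric] e(3) g21[OF assms]
    by (simp add: field_simps)
  then have "fv x \<bullet> (g c x *v fv x) = 1"
    unfolding w[symmetric] using e sigma by simp
  then show ?thesis
    using e(1,2) unfolding orthonormal_pair_def fu_def fv_def inner_matrix_sum sum_2 e_def[symmetric]
      w_def[symmetric] e(3) g21[OF assms]
    by (simp add: field_simps)
qed

lemma frame_det2:
  assumes "x \<in> N"
  shows "\<sigma> * det2 (fu x) (fv x) > 0"
proof -
  define e where "e = sqrt (g c x $ 1 $ 1)"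
  have e: "e > 0" "g c x $ 1 $ 1 = e * e"
    using g11_pos[OF assms] by (auto simp: e_def)
  have "\<sigma> * det2 (fu x) (fv x) = (\<sigma> * \<sigma>) * (1 / sqrt (gdet x))"
    unfolding det2_def fu_def fv_def e_def[symmetric] e(2) using e(1) by simp
  then show ?thesis
    using gdet_pos[OF assms] sigma by simp
qed

lemma smooth_fu: "smooth_on N (\<lambda>x. fu x $ i)"
proof -
  have "smooth_on N (\<lambda>x. 1 / sqrt (g c x $ 1 $ 1))"
    by (intro smooth_on_intros smooth_g open_N) (use g11_pos in force)+
  then show ?thesis
    using exhaust_2[of i] by (auto simp: fu_def)
qed

lemma smooth_fv: "smooth_on N (\<lambda>x. fv x $ i)"
proof -
  have "smooth_on N (\<lambda>x. - \<sigma> * g c x $ 1 $ 2 / (sqrt (g c x $ 1 $ 1) * sqrt (gdet x)))"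
    "smooth_on N (\<lambda>x. \<sigma> * g c x $ 1 $ 1 / (sqrt (g c x $ 1 $ 1) * sqrt (gdet x)))"
    by (intro smooth_on_intros smooth_g smooth_gdet open_N; use g11_pos gdet_pos in force)+
  then show ?thesis
    using exhaust_2[of i] by (auto simp: fv_def)
qed

text \<open>The connection form of the frame: the rate at which \<open>fu\<close> turns towards
  \<open>fv\<close> in direction \<open>j\<close>.\<close>

definition \<alpha> :: "2 \<Rightarrow> real^2 \<Rightarrow> real" where
  "\<alpha> j x = fv x \<bullet> (g c x *v covd j fu x)"

lemma smooth_alpha: "smooth_on N (\<alpha> j)"
  unfolding \<alpha>_def inner_matrix_sum
  by (intro smooth_on_intros smooth_g smooth_fv smooth_covd smooth_fu open_N)

text \<open>The inner products of the frame are constant on \<open>N\<close>; differentiating them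
  by \<open>metric_compatible\<close> makes the matrix of covariant derivatives skew, hence
  determined by the single entry \<open>\<alpha> j\<close>.\<close>

lemma covd_frame:
  assumes x: "x \<in> N"
  shows "covd j fu x = \<alpha> j x *\<^sub>R fv x" "covd j fv x = - \<alpha> j x *\<^sub>R fu x"
proof -
  note d = smooth_on_differentiable[OF smooth_fu x] smooth_on_differentiable[OF smooth_fv x]
  have "partial j (\<lambda>y. fu y \<bullet> (g c y *v fu y)) x = 0" "partial j (\<lambda>y. fv y \<bullet> (g c y *v fv y)) x = 0"
    "partial j (\<lambda>y. fu y \<bullet> (g c y *v fv y)) x = 0"
    using partial_cong[OF open_N x, of "\<lambda>y. fu y \<bullet> (g c y *v fu y)" "\<lambda>_. 1"]
      partial_cong[OF open_N x, of "\<lambda>y. fv y \<bullet> (g c y *v fv y)" "\<lambda>_. 1"]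
      partial_cong[OF open_N x, of "\<lambda>y. fu y \<bullet> (g c y *v fv y)" "\<lambda>_. 0"]
      frame_orthonormal by (auto simp: orthonormal_pair_def)
  then have "fu x \<bullet> (g c x *v covd j fu x) = 0" "fv x \<bullet> (g c x *v covd j fv x) = 0"
    "fu x \<bullet> (g c x *v covd j fv x) = - \<alpha> j x"
    unfolding metric_compatible[OF x d(1,1)] metric_compatible[OF x d(2,2)] metric_compatible[OF x d]
      inner_matrix_sym[OF sym_g[OF x], of "covd j fu x"] inner_matrix_sym[OF sym_g[OF x], of "covd j fv x" "fv x"]
      \<alpha>_def by auto
  then show "covd j fu x = \<alpha> j x *\<^sub>R fv x" "covd j fv x = - \<alpha> j x *\<^sub>R fu x"
    using orthonormal_expand[OF sym_g[OF x] frame_orthonormal[OF x], of "covd j fu x"]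
      orthonormal_expand[OF sym_g[OF x] frame_orthonormal[OF x], of "covd j fv x"]
    by (simp_all add: \<alpha>_def)
qed

section \<open>Covariant derivatives and curvature in terms of h_+ and h_-\<close>

abbreviation "hf s i x \<equiv> hcomp s (fu x) (fv x) i"

lemma smooth_hf: "smooth_on N (hf s i)"
  unfolding hcomp_def by (intro smooth_on_intros smooth_fu smooth_fv open_N)

lemma covariant_derivative_hf:
  assumes x: "x \<in> N"
  shows "partial j (hf s i) x + (\<Sum>l\<in>UNIV. complex_of_real (\<Gamma> x i j l) * hf s l x) =
    \<i> * of_real (sgn_of s * \<alpha> j x) * hf s i x"
proof -
  note d = smooth_on_differentiable[OF smooth_fu x] smooth_on_differentiable[OF smooth_fv x]
  have "partial j (hf s i) x = of_real (partial j (\<lambda>y. fu y $ i) x)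
      - of_real (sgn_of s) * \<i> * of_real (partial j (\<lambda>y. fv y $ i) x)"
    unfolding hcomp_def using d
    by (simp add: partial_diff partial_cmult partial_of_real differentiable_of_real differentiable_mult)
  moreover have "partial j (\<lambda>y. fu y $ i) x = \<alpha> j x * fv x $ i - (\<Sum>l\<in>UNIV. \<Gamma> x i j l * fu x $ l)"
    using arg_cong[OF covd_frame(1)[OF x, of j], of "\<lambda>v. v $ i"] by (simp add: covd_def)
  moreover have "partial j (\<lambda>y. fv y $ i) x = - \<alpha> j x * fu x $ i - (\<Sum>l\<in>UNIV. \<Gamma> x i j l * fv x $ l)"
    using arg_cong[OF covd_frame(2)[OF x, of j], of "\<lambda>v. v $ i"] by (simp add: covd_def)
  ultimately show ?thesis
    by (cases s) (simp_all add: hcomp_def sum_2 algebra_simps)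
qed

text \<open>Leibniz rule over the slots: each factor contributes \<i> times its sign times \<alpha>,
  and the signs add up to the weight.\<close>

lemma covariant_derivative_hprod:
  assumes x: "x \<in> N" and len: "length w = length I"
  shows "partial j (\<lambda>y. hprod I (fu y) (fv y) w) x +
      (\<Sum>m<length w. \<Sum>l\<in>UNIV. complex_of_real (\<Gamma> x (w ! m) j l) * hprod I (fu x) (fv x) (w[m := l])) =
    \<i> * of_real (weight I * \<alpha> j x) * hprod I (fu x) (fv x) w"
proof -
  define P where "P m = (\<Prod>b\<in>{..<length I} - {m}. hf (I ! b) (w ! b) x)" for m
  \<comment> \<open>Changing letter \<open>m\<close> of the word alters only factor
    \<open>m\<close>; the remaining factors are collected in \<open>P m\<close>.\<close>
  have upd: "hprod I (fu x) (fv x) (w[m := l]) = hf (I ! m) l x * P m" if "m < length w" for m l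
  proof -
    have "hprod I (fu x) (fv x) (w[m := l]) = hf (I ! m) (w[m := l] ! m) x *
        (\<Prod>b\<in>{..<length I} - {m}. hf (I ! b) (w[m := l] ! b) x)"
      unfolding hprod_def using that len by (intro prod.remove) auto
    also have "\<dots> = hf (I ! m) l x * P m"
      using that len by (auto simp: P_def intro!: prod.cong)
    finally show ?thesis .
  qed
  have "partial j (\<lambda>y. hprod I (fu y) (fv y) w) x = (\<Sum>m<length w. partial j (hf (I ! m) (w ! m)) x * P m)"
    unfolding hprod_def P_def len
    by (rule partial_prod) (rule smooth_on_differentiable[OF smooth_hf x])
  then have "partial j (\<lambda>y. hprod I (fu y) (fv y) w) x +
      (\<Sum>m<length w. \<Sum>l\<in>UNIV. complex_of_real (\<Gamma> x (w ! m) j l) * hprod I (fu x) (fv x) (w[m := l])) =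
      (\<Sum>m<length w. (partial j (hf (I ! m) (w ! m)) x +
        (\<Sum>l\<in>UNIV. complex_of_real (\<Gamma> x (w ! m) j l) * hf (I ! m) l x)) * P m)"
    by (simp add: upd sum.distrib[symmetric] sum_distrib_right sum_distrib_left algebra_simps)
  also have "\<dots> = (\<Sum>m<length w. \<i> * of_real (sgn_of (I ! m) * \<alpha> j x) * (hf (I ! m) (w ! m) x * P m))"
    unfolding covariant_derivative_hf[OF x] by (simp add: mult.assoc)
  \<comment> \<open>The word is reassembled as \<open>w[m := w ! m]\<close>, which is
    \<open>w\<close>.\<close>
  also have "\<dots> = (\<Sum>m<length w. \<i> * of_real (sgn_of (I ! m) * \<alpha> j x) * hprod I (fu x) (fv x) w)"
    by (intro sum.cong refl) (metis upd lessThan_iff list_update_id)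
  also have "\<dots> = \<i> * of_real (weight I * \<alpha> j x) * hprod I (fu x) (fv x) w"
    by (simp add: weight_def len sum_distrib_left sum_distrib_right)
  finally show ?thesis .
qed

text \<open>Differentiating the first-order equation of \<open>hf\<close> once more and
  antisymmetrising produces the curvature. Terms with two factors \<alpha>, or with one \<alpha> and
  one Christoffel symbol, are symmetric in the two directions and drop out.\<close>

lemma riemann_hf:
  assumes x: "x \<in> N"
  shows "(\<Sum>k\<in>UNIV. complex_of_real (riemann g c x l 1 2 k) * hf s k x) =
    \<i> * of_real (sgn_of s * (partial 1 (\<alpha> 2) x - partial 2 (\<alpha> 1) x)) * hf s l x"
proof -
  have first: "partial k (hf s l) y = \<i> * of_real (sgn_of s) * (of_real (\<alpha> k y) * hf s l y)
      - (\<Sum>m\<in>UNIV. complex_of_real (\<Gamma> y l k m) * hf s m y)" if "y \<in> N" for y k l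
    using covariant_derivative_hf[OF that, of k s l] by (simp add: algebra_simps)
  note d = smooth_on_differentiable[OF smooth_hf x] smooth_on_differentiable[OF smooth_alpha x]
    smooth_on_differentiable[OF smooth_christoffel x]
  have second: "partial j (partial k (hf s l)) x =
      \<i> * of_real (sgn_of s) * (of_real (partial j (\<alpha> k) x) * hf s l x + of_real (\<alpha> k x) * partial j (hf s l) x)
      - (\<Sum>m\<in>UNIV. of_real (partial j (\<lambda>y. \<Gamma> y l k m) x) * hf s m x + of_real (\<Gamma> x l k m) * partial j (hf s m) x)"
    for j k
  proof -
    have "partial j (partial k (hf s l)) x = partial j (\<lambda>y. \<i> * of_real (sgn_of s) * (of_real (\<alpha> k y) * hf s l y)
      - (\<Sum>m\<in>UNIV. complex_of_real (\<Gamma> y l k m) * hf s m y)) x"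
      by (rule partial_cong[OF open_N x first])
    also have "\<dots> = \<i> * of_real (sgn_of s) * partial j (\<lambda>y. of_real (\<alpha> k y) * hf s l y) x
        - (\<Sum>m\<in>UNIV. partial j (\<lambda>y. complex_of_real (\<Gamma> y l k m) * hf s m y) x)"
      using d by (simp add: partial_diff partial_cmult partial_sum differentiable_mult
          differentiable_of_real differentiable_sum)
    also have "\<dots> = \<i> * of_real (sgn_of s) * (of_real (partial j (\<alpha> k) x) * hf s l x + of_real (\<alpha> k x) * partial j (hf s l) x)
      - (\<Sum>m\<in>UNIV. of_real (partial j (\<lambda>y. \<Gamma> y l k m) x) * hf s m x + of_real (\<Gamma> x l k m) * partial j (hf s m) x)"
      using d by (simp add: partial_mult partial_of_real differentiable_of_real add.commute)
    finally show ?thesis .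
  qed
  have "partial 1 (partial 2 (hf s l)) x = partial 2 (partial 1 (hf s l)) x"
    by (rule partial_commute[OF open_N smooth_hf x])
  then show ?thesis
    unfolding second first[OF x] riemann_def sum_2
    by (simp add: algebra_simps)
qed

lemma riemann_antisym: "riemann g c x l j i k = - riemann g c x l i j k"
  by (simp add: riemann_def sum_2)

text \<open>Each row r of curvature components annihilates h_+. As r is real, the real and imaginary
  parts say that it annihilates \<open>fu\<close> and \<open>fv\<close>, which span the
  plane.\<close>

lemma flat_imp_riemann_zero:
  assumes x: "x \<in> N" and flat: "partial 1 (\<alpha> 2) x = partial 2 (\<alpha> 1) x"
  shows "riemann g c x l i j k = 0"
proof -
  have R: "(\<Sum>k\<in>UNIV. complex_of_real (riemann g c x l 1 2 k) * hf Plus k x) = 0"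
    using riemann_hf[OF x] flat by simp
  define r :: "real^2" where "r = (\<chi> k. riemann g c x l 1 2 k)"
  have "r \<bullet> fu x = 0" "r \<bullet> fv x = 0"
    using R by (simp_all add: complex_eq_iff hcomp_def inner_vec_def sum_2 r_def)
  then have "r \<bullet> w = 0" for w
    by (subst orthonormal_expand[OF sym_g[OF x] frame_orthonormal[OF x], of w]) (simp add: inner_add_right)
  then have "r = 0"
    using inner_eq_zero_iff by blast
  then have "riemann g c x l 1 2 k = 0" for k
    by (simp add: r_def vec_eq_iff)
  moreover have "riemann g c x l i i k = 0" for i k
    using riemann_antisym[of x l i i k] by simp
  ultimately show ?thesis
    using exhaust_2[of i] exhaust_2[of j] riemann_antisym[of x l 2 1 k] by auto
qed

text \<open>Inserting the dual-frame expansion into the parallel equation and applying the Leibniz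
  rule leaves a vanishing combination of products \<open>hprod\<close>; by independence each of its
  coefficients is zero, which is the last claim.\<close>

lemma coefficient_derivative:
  assumes x: "x \<in> N" and sm: "\<And>w. length w = k \<Longrightarrow> smooth_on N (t w)"
    and par: "\<And>x j w. x \<in> N \<Longrightarrow> length w = k \<Longrightarrow>
      partial j (t w) x + (\<Sum>m<length w. \<Sum>l\<in>UNIV. complex_of_real (\<Gamma> x (w ! m) j l) * t (w[m := l]) x) = 0"
    and b_def: "b = (\<lambda>I x. \<Sum>w | length w = k. hdprod (g c x) I (fu x) (fv x) w * t w x)"
  shows "length w = k \<Longrightarrow> t w x = (\<Sum>I | length I = k. b I x * hprod I (fu x) (fv x) w)"
    and "length I = k \<Longrightarrow> smooth_on N (b I)"
    and "length I = k \<Longrightarrow> partial j (b I) x = - \<i> * of_real (weight I * \<alpha> j x) * b I x"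
proof -
  have hd: "smooth_on N (\<lambda>x. hdual (g c x) s (fu x) (fv x) i)" for s i
    unfolding hdual_def divide_inverse by (intro smooth_on_intros smooth_fu smooth_fv smooth_g open_N)
  have sb: "smooth_on N (b I)" if "length I = k" for I
    unfolding b_def hdprod_def by (intro smooth_on_intros hd sm open_N) simp
  have sh: "smooth_on N (\<lambda>y. hprod I (fu y) (fv y) w)" for I w
    unfolding hprod_def by (intro smooth_on_intros smooth_hf open_N)
  have ex: "t w y = (\<Sum>I | length I = k. b I y * hprod I (fu y) (fv y) w)"
    if "y \<in> N" "length w = k" for y w
    unfolding b_def using hprod_expansion[OF sym_g[OF that(1)] frame_orthonormal[OF that(1)] that(2), of "\<lambda>w. t w y"] .
  have zero: "(\<Sum>I | length I = k. (partial j (b I) x + \<i> * of_real (weight I * \<alpha> j x) * b I x) *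
      hprod I (fu x) (fv x) w) = 0" if w: "length w = k" for w
  proof -
    have "partial j (t w) x = partial j (\<lambda>y. \<Sum>I | length I = k. b I y * hprod I (fu y) (fv y) w) x"
      by (rule partial_cong[OF open_N x ex[OF _ w]])
    also have "\<dots> = (\<Sum>I | length I = k. partial j (\<lambda>y. b I y * hprod I (fu y) (fv y) w) x)"
      by (intro partial_sum smooth_on_differentiable[OF _ x] smooth_on_mult open_N sb sh) simp
    also have "\<dots> = (\<Sum>I | length I = k. b I x * partial j (\<lambda>y. hprod I (fu y) (fv y) w) x
        + partial j (b I) x * hprod I (fu x) (fv x) w)"
      by (intro sum.cong refl partial_mult smooth_on_differentiable[OF _ x] sb sh) simp
    finally have 1: "partial j (t w) x = (\<Sum>I | length I = k. b I x * partial j (\<lambda>y. hprod I (fu y) (fv y) w) x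
        + partial j (b I) x * hprod I (fu x) (fv x) w)" .
    have 2: "(\<Sum>m<length w. \<Sum>l\<in>UNIV. complex_of_real (\<Gamma> x (w ! m) j l) * t (w[m := l]) x) =
        (\<Sum>I | length I = k. b I x *
          (\<Sum>m<length w. \<Sum>l\<in>UNIV. complex_of_real (\<Gamma> x (w ! m) j l) * hprod I (fu x) (fv x) (w[m := l])))"
      using w by (simp add: ex[OF x] sum_distrib_left sum.swap[of _ "{I. length I = k}"] mult_ac)
    have "0 = (\<Sum>I | length I = k. b I x * (partial j (\<lambda>y. hprod I (fu y) (fv y) w) x +
        (\<Sum>m<length w. \<Sum>l\<in>UNIV. complex_of_real (\<Gamma> x (w ! m) j l) * hprod I (fu x) (fv x) (w[m := l])))
        + partial j (b I) x * hprod I (fu x) (fv x) w)"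
      using par[OF x w, of j] unfolding 1 2 by (simp add: sum.distrib algebra_simps)
    also have "\<dots> = (\<Sum>I | length I = k. (partial j (b I) x + \<i> * of_real (weight I * \<alpha> j x) * b I x) *
      hprod I (fu x) (fv x) w)"
      using w by (intro sum.cong refl, subst covariant_derivative_hprod[OF x]) (simp_all add: algebra_simps)
    finally show ?thesis ..
  qed
  show "partial j (b I) x = - \<i> * of_real (weight I * \<alpha> j x) * b I x" if "length I = k"
    using hprod_independent[OF sym_g[OF x] frame_orthonormal[OF x] order_refl zero, of I] that
    by (simp add: eq_neg_iff_add_eq_0)
  show "length w = k \<Longrightarrow> t w x = (\<Sum>I | length I = k. b I x * hprod I (fu x) (fv x) w)"
    by (rule ex[OF x])
  show "length I = k \<Longrightarrow> smooth_on N (b I)"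
    by (rule sb)
qed

text \<open>A coefficient of weight \<open>n\<close> satisfies \<open>db = - \<i> n \<alpha> b\<close>, so \<open>n b d\<alpha> = 0\<close> by equality of mixed
  partial derivatives.\<close>

lemma parallel_local_form:
  assumes "connected N" and sm: "\<And>w. length w = k \<Longrightarrow> smooth_on N (t w)"
    and par: "\<And>x j w. x \<in> N \<Longrightarrow> length w = k \<Longrightarrow>
      partial j (t w) x + (\<Sum>m<length w. \<Sum>l\<in>UNIV. complex_of_real (\<Gamma> x (w ! m) j l) * t (w[m := l]) x) = 0"
    and curved: "\<And>x. x \<in> N \<Longrightarrow> \<exists>l i j m. riemann g c x l i j m \<noteq> 0"
  obtains a where "\<And>x w. x \<in> N \<Longrightarrow> length w = k \<Longrightarrow>
      t w x = (\<Sum>I\<in>balanced_words k. a I * hprod I (fu x) (fv x) w)"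
proof -
  define b where "b = (\<lambda>I x. \<Sum>w | length w = k. hdprod (g c x) I (fu x) (fv x) w * t w x)"
  have ex: "t w x = (\<Sum>I | length I = k. b I x * hprod I (fu x) (fv x) w)" if "x \<in> N" "length w = k" for x w
    using coefficient_derivative(1)[OF that(1) sm par b_def that(2)] by blast
  have D: "partial j (b I) x = - \<i> * of_real (weight I) * (of_real (\<alpha> j x) * b I x)"
    if "x \<in> N" "length I = k" for x I j
    using coefficient_derivative(3)[OF that(1) sm par b_def that(2)] by simp
  have unbalanced: "b I x = 0" if x: "x \<in> N" and I: "length I = k" and wt: "weight I \<noteq> 0" for x I
  proof -
    have sb: "smooth_on N (b I)"
      using coefficient_derivative(2)[OF x sm par b_def I] by blast
    have second: "partial i (partial j (b I)) x = - \<i> * of_real (weight I) *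
        (of_real (\<alpha> j x) * partial i (b I) x + of_real (partial i (\<alpha> j) x) * b I x)" for i j
    proof -
      have "partial i (partial j (b I)) x = partial i (\<lambda>y. - \<i> * of_real (weight I) * (of_real (\<alpha> j y) * b I y)) x"
        by (rule partial_cong[OF open_N x D[OF _ I]])
      also have "\<dots> = - \<i> * of_real (weight I) * partial i (\<lambda>y. of_real (\<alpha> j y) * b I y) x"
        by (intro partial_cmult smooth_on_differentiable[OF _ x] smooth_on_intros smooth_alpha sb open_N)
      also have "partial i (\<lambda>y. of_real (\<alpha> j y) * b I y) x =
          of_real (\<alpha> j x) * partial i (b I) x + of_real (partial i (\<alpha> j) x) * b I x"
        by (simp add: partial_mult partial_of_real differentiable_of_real
            smooth_on_differentiable[OF smooth_alpha x] smooth_on_differentiable[OF sb x])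
      finally show ?thesis .
    qed
    \<comment> \<open>Once the first-order equation is substituted, the terms quadratic in \<alpha>
      are the same in both orders of differentiation and cancel.\<close>
    have "\<i> * (of_real (weight I) * (of_real (partial 1 (\<alpha> 2) x) - of_real (partial 2 (\<alpha> 1) x)) * b I x) = 0"
      using partial_commute[OF open_N sb x, of 1 2] unfolding second D[OF x I] by algebra
    then have "of_real (weight I) * (of_real (partial 1 (\<alpha> 2) x) - of_real (partial 2 (\<alpha> 1) x)) * b I x = (0::complex)"
      by simp
    moreover have "partial 1 (\<alpha> 2) x \<noteq> partial 2 (\<alpha> 1) x"
      using curved[OF x] flat_imp_riemann_zero[OF x] by metis
    ultimately show ?thesis
      using wt by (simp flip: of_real_diff)
  qed
  have const: "b I x = b I y" if "x \<in> N" "y \<in> N" "I \<in> balanced_words k" for x y I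
  proof (rule partial_zero_imp_constant[OF open_N assms(1) _ _ that(1,2)])
    show "smooth_on N (b I)"
    proof -
      have "length I = k"
        using that(3) by (simp add: balanced_words_iff)
      then show ?thesis
        using coefficient_derivative(2)[OF that(1) sm par b_def, of I] by blast
    qed
    show "partial i (b I) z = 0" if "z \<in> N" for z i
      using D[OF that, of I i] \<open>I \<in> balanced_words k\<close> by (simp add: balanced_words_iff)
  qed
  \<comment> \<open>Balanced coefficients are constant on \<open>N\<close>, so their value at any
    one point serves; for empty \<open>N\<close> the claim is vacuous.\<close>
  define a where "a I = b I (SOME x. x \<in> N)" for I
  have "t w x = (\<Sum>I\<in>balanced_words k. a I * hprod I (fu x) (fv x) w)" if "x \<in> N" "length w = k" for x w
  proof -
    have "(SOME x. x \<in> N) \<in> N"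
      using that(1) by (rule someI)
    then have "a I = b I x" if "I \<in> balanced_words k" for I
      unfolding a_def using const that \<open>x \<in> N\<close> by blast
    then have "(\<Sum>I\<in>balanced_words k. a I * hprod I (fu x) (fv x) w) =
        (\<Sum>I\<in>balanced_words k. b I x * hprod I (fu x) (fv x) w)"
      by simp
    also have "\<dots> = (\<Sum>I | length I = k. b I x * hprod I (fu x) (fv x) w)"
      by (rule sum.mono_neutral_left) (auto simp: balanced_words_iff unbalanced[OF \<open>x \<in> N\<close>])
    finally show ?thesis
      by (simp add: ex[OF that])
  qed
  with that show ?thesis by blast
qed

end


section \<open>Tangent vectors and frames on a surface\<close>

text \<open>The tangent vector with components \<open>y\<close> in the chart \<open>c\<close>; it
  lifts frames computed in one chart to families over all charts, zero normalisation
  included.\<close>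

definition push :: "'a chart set \<Rightarrow> 'a \<Rightarrow> 'a chart \<Rightarrow> real^2 \<Rightarrow> 'a tvec" where
  "push A q c y = (\<lambda>d. if d \<in> charts_at A q then jacobian c d q *v y else 0)"

lemma continuous_on_det_matrix:
  fixes f :: "'t::topological_space \<Rightarrow> real^2^2"
  assumes "\<And>i j. continuous_on S (\<lambda>x. f x $ i $ j)"
  shows "continuous_on S (\<lambda>x. det (f x))"
  unfolding det_2 by (intro continuous_intros assms)

locale surface =
  fixes M :: "'a topology" and A :: "'a chart set" and g :: "'a metric_tensor"
  assumes riem: "riemannian_surface M A g"
begin

lemma chartD:
  assumes "c \<in> A"
  shows "openin M (cdom c)" "open (cimg c)" "cdom c \<subseteq> topspace M"
    "homeomorphic_map (subtopology M (cdom c)) (top_of_set (cimg c)) (coord c)"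
  using riem assms openin_subset
  unfolding riemannian_surface_def smooth_surface_def is_chart_def by blast+

lemma chart_inj: "c \<in> A \<Longrightarrow> inj_on (coord c) (cdom c)"
  using homeomorphic_imp_injective_map[OF chartD(4)] chartD(3)
  by (simp add: Int_absorb1)

lemma param_coord: "c \<in> A \<Longrightarrow> q \<in> cdom c \<Longrightarrow> param c (coord c q) = q"
  by (simp add: chart_inj inv_into_f_f)

lemma coord_param: "x \<in> cimg c \<Longrightarrow> coord c (param c x) = x"
  by (rule f_inv_into_f)

lemma param_in: "x \<in> cimg c \<Longrightarrow> param c x \<in> cdom c"
  by (rule inv_into_into)

lemma charts_cover: "(\<Union>c\<in>A. cdom c) = topspace M"
  using riem by (simp add: riemannian_surface_def smooth_surface_def)

lemma charts_at_iff: "c \<in> charts_at A q \<longleftrightarrow> c \<in> A \<and> q \<in> cdom c"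
  by (auto simp: charts_at_def)

lemma open_coord_image:
  assumes "c \<in> A" "openin M W"
  shows "open (coord c ` (cdom c \<inter> W))"
proof -
  have "openin (subtopology M (cdom c)) (cdom c \<inter> W)"
    using assms by (metis openin_subtopology_Int2)
  then have "openin (top_of_set (cimg c)) (coord c ` (cdom c \<inter> W))"
    using homeomorphic_map_openness_eq[OF chartD(4)[OF assms(1)]] by blast
  then show ?thesis
    using chartD(2)[OF assms(1)] openin_open_eq by blast
qed

lemma openin_coord_preimage:
  assumes "c \<in> A" "open U"
  shows "openin M {q \<in> cdom c. coord c q \<in> U}"
proof -
  have "continuous_map (subtopology M (cdom c)) euclidean (coord c)"
    using homeomorphic_imp_continuous_map[OF chartD(4)[OF assms(1)]] continuous_map_in_subtopology by blast
  then have "openin (subtopology M (cdom c)) {q \<in> topspace (subtopology M (cdom c)). coord c q \<in> U}"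
    using assms(2) by (simp add: continuous_map_def)
  moreover have "topspace (subtopology M (cdom c)) = cdom c"
    using chartD(3)[OF assms(1)] by auto
  ultimately show ?thesis
    using chartD(1)[OF assms(1)] openin_trans_full by metis
qed

lemma transition_smooth:
  assumes "c \<in> A" "d \<in> A"
  shows "smooth_on (coord c ` (cdom c \<inter> cdom d)) (transition c d)"
    and "open (coord c ` (cdom c \<inter> cdom d))"
  using riem assms open_coord_image[OF assms(1) chartD(1)[OF assms(2)]]
  unfolding riemannian_surface_def smooth_surface_def compatible_def by blast+

lemma transition_coord: "c \<in> A \<Longrightarrow> q \<in> cdom c \<Longrightarrow> transition c d (coord c q) = coord d q"
  by (simp add: transition_def param_coord)

lemma transition_has_derivative:
  assumes "c \<in> charts_at A q" "d \<in> charts_at A q"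
  shows "(transition c d has_derivative (\<lambda>v. jacobian c d q *v v)) (at (coord c q))"
proof -
  have "transition c d differentiable (at (coord c q))"
    using assms smooth_on_differentiable[OF transition_smooth(1), of c d "coord c q"] by (auto simp: charts_at_iff)
  then have *: "(transition c d has_derivative frechet_derivative (transition c d) (at (coord c q))) (at (coord c q))"
    by (simp add: frechet_derivative_works)
  then show ?thesis
    by (simp add: jacobian_def matrix_vector_mul(2)[OF has_derivative_linear[OF *]])
qed

lemma jacobian_eqI:
  assumes "c \<in> charts_at A q" "d \<in> charts_at A q"
    and "(transition c d has_derivative (\<lambda>v. J *v v)) (at (coord c q))"
  shows "jacobian c d q = J"
proof -
  have "(\<lambda>v. jacobian c d q *v v) = (\<lambda>v. J *v v)"
    by (rule has_derivative_unique[OF transition_has_derivative[OF assms(1,2)] assms(3)])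
  then show ?thesis
    by (metis matrix_eq)
qed

text \<open>Chain rule for transition maps. The composite is known to agree with
  \<open>transition c e\<close> on the image of the triple overlap, which is open and contains the
  point.\<close>

lemma jacobian_mult:
  assumes "c \<in> charts_at A q" "d \<in> charts_at A q" "e \<in> charts_at A q"
  shows "jacobian d e q ** jacobian c d q = jacobian c e q"
proof (rule jacobian_eqI[OF assms(1,3), symmetric])
  let ?U = "coord c ` (cdom c \<inter> (cdom d \<inter> cdom e))"
  have "open ?U"
    using assms by (intro open_coord_image openin_Int chartD) (auto simp: charts_at_iff)
  moreover have "(transition d e \<circ> transition c d has_derivative
      (\<lambda>v. jacobian d e q *v v) \<circ> (\<lambda>v. jacobian c d q *v v)) (at (coord c q))"
    using assms transition_has_derivative[OF assms(2,3)]
    by (intro diff_chain_at transition_has_derivative) (auto simp: transition_coord charts_at_iff)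
  moreover have "(transition d e \<circ> transition c d) x = transition c e x" if "x \<in> ?U" for x
    using that assms by (auto simp: transition_coord charts_at_iff)
  moreover have "coord c q \<in> ?U"
    using assms by (auto simp: charts_at_iff)
  ultimately have "(transition c e has_derivative (\<lambda>v. jacobian d e q *v v) \<circ> (\<lambda>v. jacobian c d q *v v)) (at (coord c q))"
    using has_derivative_transform_within_open by blast
  then show "(transition c e has_derivative (\<lambda>v. (jacobian d e q ** jacobian c d q) *v v)) (at (coord c q))"
    by (simp add: o_def matrix_vector_mul_assoc)
qed

lemma jacobian_refl:
  assumes "c \<in> charts_at A q"
  shows "jacobian c c q = mat 1"
proof (rule jacobian_eqI[OF assms assms])
  have c: "c \<in> A" "q \<in> cdom c"
    using assms by (simp_all add: charts_at_iff)
  have "(transition c c has_derivative (\<lambda>v. v)) (at (coord c q))"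
  proof (rule has_derivative_transform_within_open[OF has_derivative_ident chartD(2)[OF c(1)]])
    show "coord c q \<in> cimg c"
      using c(2) by blast
    show "x = transition c c x" if "x \<in> cimg c" for x
      using that transition_coord[OF c(1), of _ c] by auto
  qed
  then show "(transition c c has_derivative (\<lambda>v. mat 1 *v v)) (at (coord c q))"
    by simp
qed

lemma det_jacobian_nonzero:
  assumes "c \<in> charts_at A q" "d \<in> charts_at A q"
  shows "det (jacobian c d q) \<noteq> 0"
proof
  assume "det (jacobian c d q) = 0"
  then have "det (jacobian d c q ** jacobian c d q) = 0"
    by (simp add: det_mul)
  then show False
    by (simp add: jacobian_mult[OF assms assms(1)] jacobian_refl[OF assms(1)])
qed

lemma tangentD:
  "v \<in> tangent_space A q \<Longrightarrow> c \<in> charts_at A q \<Longrightarrow> d \<in> charts_at A q \<Longrightarrow> v d = jacobian c d q *v v c"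
  "v \<in> tangent_space A q \<Longrightarrow> c \<notin> charts_at A q \<Longrightarrow> v c = 0"
  unfolding tangent_space_def mem_Collect_eq by blast+

lemma push_self: "c \<in> charts_at A q \<Longrightarrow> push A q c y c = y"
  by (simp add: push_def jacobian_refl)

lemma push_tangent: "c \<in> charts_at A q \<Longrightarrow> push A q c y \<in> tangent_space A q"
  by (simp add: tangent_space_def push_def matrix_vector_mul_assoc jacobian_mult)

lemma metric_smooth: "c \<in> A \<Longrightarrow> smooth_on (cimg c) (\<lambda>x. g c x $ i $ j)"
  using riem by (simp add: riemannian_surface_def riemannian_metric_def)

lemma gram_field: "c \<in> A \<Longrightarrow> open N \<Longrightarrow> N \<subseteq> cimg c \<Longrightarrow> gram_field g c N"
  using riem smooth_on_subset[OF metric_smooth]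
  unfolding gram_field_def riemannian_surface_def riemannian_metric_def by blast

lemma metric_invariant:
  assumes "u \<in> tangent_space A q" "v \<in> tangent_space A q" "c \<in> charts_at A q" "d \<in> charts_at A q"
  shows "u c \<bullet> (g c (coord c q) *v v c) = u d \<bullet> (g d (coord d q) *v v d)"
proof -
  let ?J = "jacobian c d q"
  have "g c (coord c q) = transpose ?J ** g d (coord d q) ** ?J"
    using riem assms unfolding riemannian_surface_def riemannian_metric_def by (auto simp: charts_at_iff)
  then have "u c \<bullet> (g c (coord c q) *v v c) = u c \<bullet> (transpose ?J *v (g d (coord d q) *v (?J *v v c)))"
    by (simp add: matrix_vector_mul_assoc matrix_mul_assoc)
  also have "\<dots> = (?J *v u c) \<bullet> (g d (coord d q) *v (?J *v v c))"
    by (metis dot_lmul_matrix inner_commute matrix_transpose_mul transpose_matrix_vector transpose_transpose)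
  finally show ?thesis
    using tangentD(1)[OF assms(1,3,4)] tangentD(1)[OF assms(2,3,4)] by simp
qed

lemma orthonormal_basis_at_alt:
  "orthonormal_basis_at A g q u v \<longleftrightarrow> u \<in> tangent_space A q \<and> v \<in> tangent_space A q \<and>
     (\<forall>c\<in>charts_at A q. orthonormal_pair (g c (coord c q)) (u c) (v c))"
  unfolding orthonormal_basis_at_def orthonormal_pair_def ip_def ..

lemma orthonormal_basis_at_iff:
  assumes "u \<in> tangent_space A q" "v \<in> tangent_space A q" "c \<in> charts_at A q"
  shows "orthonormal_basis_at A g q u v \<longleftrightarrow> orthonormal_pair (g c (coord c q)) (u c) (v c)"
proof -
  have "orthonormal_pair (g d (coord d q)) (u d) (v d) \<longleftrightarrow> orthonormal_pair (g c (coord c q)) (u c) (v c)"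
    if "d \<in> charts_at A q" for d
    unfolding orthonormal_pair_def
    using metric_invariant[OF assms(1,1,3) that] metric_invariant[OF assms(2,2,3) that]
      metric_invariant[OF assms(1,2,3) that] by simp
  then show ?thesis
    unfolding orthonormal_basis_at_alt using assms by blast
qed

end

text \<open>\<open>B\<close> is an oriented subatlas, and the sign of \<open>e\<close> selects one
  of the two orientation classes. It is left free because a prescribed basis may be negative with
  respect to \<open>B\<close>.\<close>

locale oriented_surface = surface M A g for M :: "'a topology" and A g +
  fixes B :: "'a chart set" and e :: real
  assumes B_sub: "B \<subseteq> A" and B_cover: "(\<Union>c\<in>B. cdom c) = topspace M"
    and B_pos: "\<And>c d q. c \<in> B \<Longrightarrow> d \<in> B \<Longrightarrow> q \<in> cdom c \<Longrightarrow> q \<in> cdom d \<Longrightarrow> det (jacobian c d q) > 0"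
    and e_nonzero: "e \<noteq> 0"
begin

text \<open>Orthonormal frames in the orientation class selected by the sign of \<open>e\<close>.\<close>

definition framing :: "'a \<Rightarrow> 'a tvec \<Rightarrow> 'a tvec \<Rightarrow> bool" where
  "framing q u v \<longleftrightarrow> orthonormal_basis_at A g q u v \<and> (\<forall>d\<in>B. q \<in> cdom d \<longrightarrow> e * det2 (u d) (v d) > 0)"

lemma B_charts_at: "d \<in> B \<Longrightarrow> q \<in> cdom d \<Longrightarrow> d \<in> charts_at A q"
  using B_sub by (auto simp: charts_at_iff)

lemma B_at: "q \<in> topspace M \<Longrightarrow> \<exists>d\<in>B. q \<in> cdom d"
  using B_cover by blast

lemma det2_change:
  assumes "u \<in> tangent_space A q" "v \<in> tangent_space A q" "c \<in> charts_at A q" "d \<in> charts_at A q"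
  shows "det2 (u d) (v d) = det (jacobian c d q) * det2 (u c) (v c)"
  using tangentD(1)[OF assms(1,3,4)] tangentD(1)[OF assms(2,3,4)] by (simp add: det2_matrix)

text \<open>Charts of \<open>B\<close> differ by positive Jacobian determinants, by which
  \<open>det2\<close> scales, so the sign need be checked in one chart of \<open>B\<close> only;
  orthonormality is invariant under all chart changes.\<close>

lemma framing_iff:
  assumes "u \<in> tangent_space A q" "v \<in> tangent_space A q" "c \<in> charts_at A q" "d \<in> B" "q \<in> cdom d"
  shows "framing q u v \<longleftrightarrow> orthonormal_pair (g c (coord c q)) (u c) (v c) \<and> e * det2 (u d) (v d) > 0"
proof -
  have "e * det2 (u d') (v d') > 0" if "e * det2 (u d) (v d) > 0" "d' \<in> B" "q \<in> cdom d'" for d'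
  proof -
    have "e * det2 (u d') (v d') = det (jacobian d d' q) * (e * det2 (u d) (v d))"
      using det2_change[OF assms(1,2) B_charts_at[OF assms(4,5)] B_charts_at[OF that(2,3)]] by simp
    then show ?thesis
      using mult_pos_pos[OF B_pos[OF assms(4) that(2) assms(5) that(3)] that(1)] by (simp only:)
  qed
  then show ?thesis
    unfolding framing_def orthonormal_basis_at_iff[OF assms(1-3)] using assms(4,5) by blast
qed

lemma framingD:
  assumes "framing q u v"
  shows "u \<in> tangent_space A q" "v \<in> tangent_space A q"
    "c \<in> charts_at A q \<Longrightarrow> orthonormal_pair (g c (coord c q)) (u c) (v c)"
  using assms unfolding framing_def orthonormal_basis_at_alt by blast+

lemma metric_sym: "c \<in> charts_at A q \<Longrightarrow> transpose (g c (coord c q)) = g c (coord c q)"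
  using gram_field.sym_g[OF gram_field[OF _ chartD(2) order_refl], of c] by (auto simp: charts_at_iff)

text \<open>In a chart outside \<open>B\<close> both determinants may be of either sign, but passing
  to a chart of \<open>B\<close> multiplies their product by a square.\<close>

lemma framing_same_orientation:
  assumes "framing q u v" "framing q u' v'" "q \<in> topspace M" "c \<in> charts_at A q"
  shows "det2 (u c) (v c) * det2 (u' c) (v' c) > 0"
proof -
  obtain d where d: "d \<in> B" "q \<in> cdom d"
    using B_at[OF assms(3)] by blast
  then have dc: "d \<in> charts_at A q"
    by (rule B_charts_at)
  have "e * det2 (u d) (v d) > 0" "e * det2 (u' d) (v' d) > 0"
    using assms(1,2) d unfolding framing_def by blast+
  then have "(e * det2 (u d) (v d)) * (e * det2 (u' d) (v' d)) > 0"
    by (rule mult_pos_pos)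
  also have "(e * det2 (u d) (v d)) * (e * det2 (u' d) (v' d)) =
      (e * det (jacobian c d q))\<^sup>2 * (det2 (u c) (v c) * det2 (u' c) (v' c))"
    unfolding det2_change[OF framingD(1,2)[OF assms(1)] assms(4) dc]
      det2_change[OF framingD(1,2)[OF assms(2)] assms(4) dc]
    by (simp add: power2_eq_square algebra_simps)
  finally show ?thesis
    by (metis zero_less_mult_pos zero_less_power2 mult_zero_left less_irrefl power2_eq_square)
qed

lemma hprod_framing_unique:
  assumes "framing q u v" "framing q u' v'" "q \<in> topspace M" "c \<in> charts_at A q"
    and "I \<in> balanced_words k"
  shows "hprod I (u c) (v c) w = hprod I (u' c) (v' c) w"
proof -
  obtain z :: "sign \<Rightarrow> complex" where z: "z Plus * z Minus = 1"
    "\<And>s i. hcomp s (u' c) (v' c) i = z s * hcomp s (u c) (v c) i"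
    using orthonormal_rotation[OF metric_sym[OF assms(4)] framingD(3)[OF assms(1,4)] framingD(3)[OF assms(2,4)]
        framing_same_orientation[OF assms(1-4)]] by blast
  have "hprod I (u' c) (v' c) w = (\<Prod>m<length I. z (I ! m)) * hprod I (u c) (v c) w"
    by (simp add: hprod_def z(2) prod.distrib)
  moreover have "(\<Prod>m<length I. z (I ! m)) = 1"
    using prod_phase_balanced[of I "length I" z] assms(5) z(1) by (simp add: balanced_words_def)
  ultimately show ?thesis by simp
qed

text \<open>The given chart need not be positively oriented. Its Jacobian determinant towards a
  chart of \<open>B\<close> is continuous and nonzero, so \<open>e\<close> times it has constant
  sign on a small ball, and \<open>\<sigma>\<close> corrects the Gram-Schmidt frame there. A ball
  also provides the connectedness on which constant coefficients rest.\<close>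

lemma local_framing:
  assumes c: "c \<in> A" and q: "q \<in> cdom c"
  obtains N \<sigma> where "open N" "connected N" "coord c q \<in> N" "N \<subseteq> cimg c" "gram_frame g c N \<sigma>"
    "\<And>x. x \<in> N \<Longrightarrow> framing (param c x) (push A (param c x) c (gram_frame.fu g c x))
        (push A (param c x) c (gram_frame.fv g c \<sigma> x))"
proof -
  obtain d where d: "d \<in> B" "q \<in> cdom d" "d \<in> A"
    using B_at chartD(3)[OF c] q B_sub by blast
  let ?U = "coord c ` (cdom c \<inter> cdom d)"
  define f where "f x = e * det (jacobian c d (param c x))" for x
  have "continuous_on ?U (\<lambda>x. jacobian c d (param c x) $ i $ j)" for i j
  proof -
    have "continuous_on ?U (\<lambda>x. partial j (transition c d) x $ i)"
      by (intro continuous_on_component smooth_on_continuous smooth_on_partial transition_smooth c d)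
    moreover have "jacobian c d (param c x) $ i $ j = partial j (transition c d) x $ i" if "x \<in> ?U" for x
      using that c by (auto simp: jacobian_def matrix_def partial_def param_coord)
    ultimately show ?thesis
      by (simp cong: continuous_on_cong)
  qed
  then have f_cont: "continuous_on ?U f"
    unfolding f_def by (intro continuous_on_mult_left continuous_on_det_matrix)
  have Uopen: "open ?U"
    by (rule transition_smooth(2)[OF c d(3)])
  have qU: "coord c q \<in> ?U"
    using q d by blast
  have "f (coord c q) \<noteq> 0"
    using det_jacobian_nonzero[of c q d] c q d e_nonzero by (simp add: f_def param_coord charts_at_iff)
  define \<sigma> where "\<sigma> = sgn (f (coord c q))"
  have sig: "\<sigma> * \<sigma> = 1" "\<sigma> * f (coord c q) > 0"
    using \<open>f (coord c q) \<noteq> 0\<close> by (auto simp: \<sigma>_def sgn_if)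
  have "open ((\<lambda>x. \<sigma> * f x) -` {0<..} \<inter> ?U)"
    using continuous_on_mult_left[OF f_cont, of \<sigma>] continuous_on_open_vimage[OF Uopen] open_greaterThan by blast
  then obtain r where r: "r > 0" "ball (coord c q) r \<subseteq> (\<lambda>x. \<sigma> * f x) -` {0<..} \<inter> ?U"
    using qU sig(2) openE[of _ "coord c q"] by (metis IntI greaterThan_iff vimageI)
  let ?N = "ball (coord c q) r"
  have sub: "?N \<subseteq> cimg c"
    using r(2) by blast
  interpret gram_frame g c ?N \<sigma>
    using gram_field[OF c open_ball sub] sig(1) by (simp add: gram_frame_def gram_frame_axioms_def)
  have "framing (param c x) (push A (param c x) c (fu x)) (push A (param c x) c (fv x))" if x: "x \<in> ?N" for x
  proof -
    have xU: "x \<in> ?U" and pos: "\<sigma> * f x > 0"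
      using r(2) x by auto
    have pc: "param c x \<in> cdom c \<inter> cdom d" and cp: "coord c (param c x) = x"
      using xU c by (auto simp: param_coord)
    then have at: "c \<in> charts_at A (param c x)" "d \<in> charts_at A (param c x)"
      using c d by (auto simp: charts_at_iff)
    have "e * det2 (push A (param c x) c (fu x) d) (push A (param c x) c (fv x) d) =
        f x * det2 (fu x) (fv x)"
      by (simp add: push_def at(2) det2_matrix f_def)
    \<comment> \<open>Inserting \<sigma>^2 = 1 splits the product into two factors known to be
      positive.\<close>
    also have "\<dots> = (\<sigma> * f x) * (\<sigma> * det2 (fu x) (fv x))"
      using sig(1) by (simp add: algebra_simps)
    also have "\<dots> > 0"
      using pos frame_det2[OF x] by (rule mult_pos_pos)
    finally show ?thesis
      using framing_iff[OF push_tangent[OF at(1)] push_tangent[OF at(1)] at(1) d(1)] pc frame_orthonormal[OF x]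
      by (simp add: push_self[OF at(1)] cp)
  qed
  then show ?thesis
    using that[of ?N \<sigma>] r(1) sub gram_frame_axioms by simp
qed

lemma framing_exists:
  assumes "q \<in> topspace M"
  shows "\<exists>u v. framing q u v"
proof -
  obtain c where c: "c \<in> A" "q \<in> cdom c"
    using assms charts_cover by blast
  show ?thesis
  proof (rule local_framing[OF c])
    fix N \<sigma>
    assume "coord c q \<in> N" and fr: "\<And>x. x \<in> N \<Longrightarrow> framing (param c x) (push A (param c x) c (gram_frame.fu g c x))
        (push A (param c x) c (gram_frame.fv g c \<sigma> x))"
    then show ?thesis
      using fr[of "coord c q"] unfolding param_coord[OF c] by blast
  qed
qed

end


section \<open>Parallel transport\<close>

text \<open>Serves functions along a path that are defined through varying charts: a relatively open
  piece of \<open>S\<close> gives the same filter at its points as \<open>S\<close> does.\<close>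

lemma continuous_on_locally:
  fixes f :: "'s::t2_space \<Rightarrow> 't::topological_space"
  assumes "\<And>t. t \<in> S \<Longrightarrow> \<exists>T h. openin (top_of_set S) T \<and> t \<in> T \<and> continuous_on T h \<and> (\<forall>x\<in>T. f x = h x)"
  shows "continuous_on S f"
  unfolding continuous_on_eq_continuous_within
proof
  fix t assume t: "t \<in> S"
  then obtain T h where T: "openin (top_of_set S) T" "t \<in> T" "continuous_on T h" "\<forall>x\<in>T. f x = h x"
    using assms by blast
  then have "continuous_on T f"
    by (simp cong: continuous_on_cong)
  then have "continuous (at t within T) f"
    using T(2) by (simp add: continuous_on_eq_continuous_within)
  moreover obtain U where "open U" "T = S \<inter> U"
    using T(1) by (auto simp: openin_open)
  then have "at t within T = at t within S"
    using T(2) by (intro at_within_nhd[of t U]) auto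
  ultimately show "continuous (at t within S) f" by simp
qed

lemma has_real_derivative_along:
  fixes f :: "real^2 \<Rightarrow> real"
  assumes "(x has_vector_derivative x') (at t)" "f differentiable (at (x t))"
  shows "((\<lambda>s. f (x s)) has_real_derivative (\<Sum>i\<in>UNIV. partial i f (x t) * x' $ i)) (at t)"
proof -
  have "((\<lambda>s. f (x s)) has_derivative (\<lambda>h. \<Sum>i\<in>UNIV. (h *\<^sub>R x') $ i *\<^sub>R partial i f (x t))) (at t)"
    by (rule has_derivative_compose[OF assms(1)[unfolded has_vector_derivative_def]
          has_derivative_partial[OF assms(2)]])
  also have "(\<lambda>h. \<Sum>i\<in>UNIV. (h *\<^sub>R x') $ i *\<^sub>R partial i f (x t)) = (*) (\<Sum>i\<in>UNIV. partial i f (x t) * x' $ i)"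
    by (rule ext) (simp add: sum_2 algebra_simps)
  finally show ?thesis
    by (simp add: has_field_derivative_def)
qed

lemma has_real_derivative_component:
  fixes y :: "real \<Rightarrow> real^2"
  assumes "(y has_vector_derivative y') (at t)"
  shows "((\<lambda>s. y s $ i) has_real_derivative y' $ i) (at t)"
  using bounded_linear.has_vector_derivative[OF bounded_linear_vec_nth assms]
  by (simp add: has_real_derivative_iff_has_vector_derivative)

context surface
begin

lemma coord_continuous:
  "c \<in> A \<Longrightarrow> continuous_map (subtopology M (cdom c)) euclidean (coord c)"
  using homeomorphic_imp_continuous_map[OF chartD(4)] continuous_map_in_subtopology by blast

definition parallel_field :: "(real \<Rightarrow> 'a) \<Rightarrow> (real \<Rightarrow> 'a tvec) \<Rightarrow> bool" where
  "parallel_field \<gamma> Y \<longleftrightarrow> (\<forall>t\<in>{0..1}. Y t \<in> tangent_space A (\<gamma> t)) \<and>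
     (\<forall>c\<in>A. continuous_on {t \<in> {0..1}. \<gamma> t \<in> cdom c} (\<lambda>t. Y t c)) \<and>
     (\<exists>S. finite S \<and> (\<forall>t\<in>{0..1} - S. parallel_at A g \<gamma> Y t))"

lemma parallel_transport_iff:
  "parallel_transport A g \<gamma> v w \<longleftrightarrow> (\<exists>Y. parallel_field \<gamma> Y \<and> Y 0 = v \<and> Y 1 = w)"
  unfolding parallel_transport_def parallel_field_def by blast

context
  fixes \<gamma> :: "real \<Rightarrow> 'a"
  assumes path: "piecewise_C1_path M A \<gamma>"
begin

lemma path_continuous: "continuous_map (top_of_set {0..1}) M \<gamma>"
  using path by (simp add: piecewise_C1_path_def)

lemma path_in: "t \<in> {0..1} \<Longrightarrow> \<gamma> t \<in> topspace M"
  using continuous_map_funspace[OF path_continuous] by auto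

lemma path_chart_open: "c \<in> A \<Longrightarrow> openin (top_of_set {0..1}) {t \<in> {0..1}. \<gamma> t \<in> cdom c}"
  using openin_continuous_map_preimage[OF path_continuous chartD(1)] by simp

lemma path_coord_continuous:
  assumes "c \<in> A"
  shows "continuous_on {t \<in> {0..1}. \<gamma> t \<in> cdom c} (\<lambda>t. coord c (\<gamma> t))"
proof -
  have "continuous_map (top_of_set {t \<in> {0..1}. \<gamma> t \<in> cdom c}) M \<gamma>"
    by (rule continuous_map_from_subtopology_mono[OF path_continuous]) auto
  then have "continuous_map (top_of_set {t \<in> {0..1}. \<gamma> t \<in> cdom c}) (subtopology M (cdom c)) \<gamma>"
    by (rule continuous_map_into_subtopology) auto
  from continuous_map_compose[OF this coord_continuous[OF assms]] show ?thesis
    by (simp add: o_def)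
qed

text \<open>Metric compatibility along a curve: by \<open>partial_g\<close> the chain rule term of
  the Gram matrix cancels the two connection terms.\<close>

lemma inner_product_derivative_zero:
  assumes c: "c \<in> charts_at A (\<gamma> t)" and Y: "parallel_at A g \<gamma> Y t" and Z: "parallel_at A g \<gamma> Z t"
    and vd: "(coord c \<circ> \<gamma>) differentiable (at t)"
  shows "((\<lambda>s. Y s c \<bullet> (g c (coord c (\<gamma> s)) *v Z s c)) has_real_derivative 0) (at t)"
proof -
  interpret gram_field g c "cimg c"
    using gram_field chartD(2) c by (simp add: charts_at_iff)
  define x' where "x' = vector_derivative (coord c \<circ> \<gamma>) (at t)"
  define x where "x = coord c (\<gamma> t)"
  have x: "x \<in> cimg c"
    using c by (simp add: x_def charts_at_iff)
  have "((coord c \<circ> \<gamma>) has_vector_derivative x') (at t)"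
    using vd by (simp add: x'_def vector_derivative_works)
  then have gd: "((\<lambda>s. g c (coord c (\<gamma> s)) $ a $ b) has_real_derivative
      (\<Sum>i\<in>UNIV. partial i (\<lambda>y. g c y $ a $ b) x * x' $ i)) (at t)" for a b
    using has_real_derivative_along[of "coord c \<circ> \<gamma>" x' t "\<lambda>y. g c y $ a $ b"]
      smooth_on_differentiable[OF smooth_g x] by (simp add: x_def)
  have yd: "((\<lambda>s. Y s c $ a) has_real_derivative - connection_form g c x x' (Y t c) $ a) (at t)"
    "((\<lambda>s. Z s c $ a) has_real_derivative - connection_form g c x x' (Z t c) $ a) (at t)" for a
    using Y Z c has_real_derivative_component[of "\<lambda>s. Y s c" "- connection_form g c x x' (Y t c)" t a]
      has_real_derivative_component[of "\<lambda>s. Z s c" "- connection_form g c x x' (Z t c)" t a]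
    by (simp_all add: parallel_at_def x_def x'_def)
  have "((\<lambda>s. Y s c \<bullet> (g c (coord c (\<gamma> s)) *v Z s c)) has_real_derivative
      (\<Sum>a\<in>UNIV. \<Sum>b\<in>UNIV. ((\<Sum>i\<in>UNIV. partial i (\<lambda>y. g c y $ a $ b) x * x' $ i) * Y t c $ a +
          - connection_form g c x x' (Y t c) $ a * g c x $ a $ b) * Z t c $ b +
        - connection_form g c x x' (Z t c) $ b * (g c x $ a $ b * Y t c $ a))) (at t)"
    unfolding inner_matrix_sum x_def
    by (intro DERIV_sum DERIV_mult' DERIV_mult gd[unfolded x_def] yd[unfolded x_def])
  moreover have "(\<Sum>a\<in>UNIV. \<Sum>b\<in>UNIV. ((\<Sum>i\<in>UNIV. partial i (\<lambda>y. g c y $ a $ b) x * x' $ i) * Y t c $ a +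
          - connection_form g c x x' (Y t c) $ a * g c x $ a $ b) * Z t c $ b +
        - connection_form g c x x' (Z t c) $ b * (g c x $ a $ b * Y t c $ a)) = 0"
    unfolding partial_g[OF x] connection_form_def by (simp add: sum_2 g21[OF x] algebra_simps)
  ultimately show ?thesis by simp
qed

lemma parallel_inner_product_constant:
  assumes Y: "parallel_field \<gamma> Y" and Z: "parallel_field \<gamma> Z"
    and t: "t \<in> {0..1}" and c: "c \<in> charts_at A (\<gamma> 0)" and d: "d \<in> charts_at A (\<gamma> t)"
  shows "Y t d \<bullet> (g d (coord d (\<gamma> t)) *v Z t d) = Y 0 c \<bullet> (g c (coord c (\<gamma> 0)) *v Z 0 c)"
proof -
  \<comment> \<open>The path may leave every single chart, so the inner product is written with a
    chosen chart at each parameter; \<open>metric_invariant\<close> makes the choice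
    immaterial.\<close>
  define F where "F t = (let c = SOME c. c \<in> charts_at A (\<gamma> t) in Y t c \<bullet> (g c (coord c (\<gamma> t)) *v Z t c))" for t
  have F: "F t = Y t c \<bullet> (g c (coord c (\<gamma> t)) *v Z t c)" if "t \<in> {0..1}" "c \<in> charts_at A (\<gamma> t)" for t c
    using that Y Z metric_invariant[OF _ _ someI[of "\<lambda>c. c \<in> charts_at A (\<gamma> t)", OF that(2)] that(2)]
    unfolding F_def Let_def parallel_field_def by blast
  have cover: "\<exists>c\<in>A. \<gamma> t \<in> cdom c" if "t \<in> {0..1}" for t
    using path_in[OF that] charts_cover by blast
  have "continuous_on {0..1} F"
  proof (rule continuous_on_locally)
    fix t :: real assume t: "t \<in> {0..1}"
    obtain c where c: "c \<in> A" "\<gamma> t \<in> cdom c"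
      using cover[OF t] by blast
    let ?T = "{t \<in> {0..1}. \<gamma> t \<in> cdom c}"
    have gc: "continuous_on ?T (\<lambda>t. g c (coord c (\<gamma> t)) $ a $ b)" for a b
      by (rule continuous_on_compose2[OF smooth_on_continuous[OF metric_smooth[OF c(1)]] path_coord_continuous[OF c(1)]])
        auto
    have yc: "continuous_on ?T (\<lambda>t. Y t c)" "continuous_on ?T (\<lambda>t. Z t c)"
      using Y Z c(1) unfolding parallel_field_def by blast+
    have "continuous_on ?T (\<lambda>t. Y t c \<bullet> (g c (coord c (\<gamma> t)) *v Z t c))"
      unfolding inner_matrix_sum by (intro continuous_on_sum continuous_on_mult gc continuous_on_component[OF yc(1)]
          continuous_on_component[OF yc(2)])
    moreover have "F s = Y s c \<bullet> (g c (coord c (\<gamma> s)) *v Z s c)" if "s \<in> ?T" for s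
      using F[of s c] that c(1) by (simp add: charts_at_iff)
    ultimately show "\<exists>T h. openin (top_of_set {0..1}) T \<and> t \<in> T \<and> continuous_on T h \<and> (\<forall>x\<in>T. F x = h x)"
      using path_chart_open[OF c(1)] t c(2) by blast
  qed
  moreover obtain S0 where S0: "finite S0"
    "\<And>c. c \<in> A \<Longrightarrow> (coord c \<circ> \<gamma>) C1_differentiable_on {t \<in> {0..1} - S0. \<gamma> t \<in> cdom c}"
    using path unfolding piecewise_C1_path_def by blast
  obtain S1 where S1: "finite S1" "\<And>t. t \<in> {0..1} - S1 \<Longrightarrow> parallel_at A g \<gamma> Y t"
    using Y unfolding parallel_field_def by blast
  obtain S2 where S2: "finite S2" "\<And>t. t \<in> {0..1} - S2 \<Longrightarrow> parallel_at A g \<gamma> Z t"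
    using Z unfolding parallel_field_def by blast
  \<comment> \<open>The end points join the exceptional set because the fields are controlled only
    on [0,1], while the derivatives are two-sided.\<close>
  let ?S = "S0 \<union> S1 \<union> S2 \<union> {0, 1}"
  have "(F has_derivative (\<lambda>h. 0)) (at s within {0..1})" if s: "s \<in> {0..1} - ?S" for s
  proof -
    obtain c where c: "c \<in> A" "\<gamma> s \<in> cdom c"
      using cover s by blast
    obtain U where U: "open U" "{t \<in> {0..1}. \<gamma> t \<in> cdom c} = {0..1} \<inter> U"
      using path_chart_open[OF c(1)] by (auto simp: openin_open)
    have "(coord c \<circ> \<gamma>) differentiable (at s)"
      using S0(2)[OF c(1)] s c(2) by (simp add: C1_differentiable_on_eq)
    moreover have "parallel_at A g \<gamma> Y s" "parallel_at A g \<gamma> Z s"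
      using S1(2) S2(2) s by blast+
    ultimately have "((\<lambda>s. Y s c \<bullet> (g c (coord c (\<gamma> s)) *v Z s c)) has_real_derivative 0) (at s)"
      using c by (intro inner_product_derivative_zero) (auto simp: charts_at_iff)
    then have "((\<lambda>s. Y s c \<bullet> (g c (coord c (\<gamma> s)) *v Z s c)) has_derivative (\<lambda>h. 0)) (at s)"
      by (simp add: has_field_derivative_def lambda_zero)
    then have "(F has_derivative (\<lambda>h. 0)) (at s)"
    proof (rule has_derivative_transform_within_open)
      show "open ({0<..<1} \<inter> U)"
        using U(1) by auto
      show "s \<in> {0<..<1} \<inter> U"
        using U(2) s c(2) by (auto simp: less_le)
      show "Y r c \<bullet> (g c (coord c (\<gamma> r)) *v Z r c) = F r" if "r \<in> {0<..<1} \<inter> U" for r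
      proof -
        have "r \<in> {t \<in> {0..1}. \<gamma> t \<in> cdom c}"
          unfolding U(2) using that by simp
        then show ?thesis
          using F[of r c] c(1) by (simp add: charts_at_iff)
      qed
    qed
    then show ?thesis
      by (rule has_derivative_at_withinI)
  qed
  moreover have "finite ?S"
    using S0(1) S1(1) S2(1) by simp
  ultimately have "F t = F 0"
    using has_derivative_zero_unique_strong_interval[of ?S 0 1 F "F 0" t] t by blast
  then show ?thesis
    using F[OF t d] F[of 0 c] c by simp
qed

end

end

context oriented_surface
begin

lemma transport_framing:
  assumes path: "piecewise_C1_path M A \<gamma>"
    and 1: "parallel_transport A g \<gamma> u u'" and 2: "parallel_transport A g \<gamma> v v'"
    and fr: "framing (\<gamma> 0) u v"
  shows "framing (\<gamma> 1) u' v'"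
proof -
  obtain Y Z where Y: "parallel_field \<gamma> Y" "Y 0 = u" "Y 1 = u'" and Z: "parallel_field \<gamma> Z" "Z 0 = v" "Z 1 = v'"
    using 1 2 parallel_transport_iff by blast
  have tan: "Y t \<in> tangent_space A (\<gamma> t)" "Z t \<in> tangent_space A (\<gamma> t)" if "t \<in> {0..1}" for t
    using Y Z that unfolding parallel_field_def by blast+
  have "\<gamma> 0 \<in> topspace M"
    by (rule path_in[OF path]) simp
  then obtain c0 where "c0 \<in> A" "\<gamma> 0 \<in> cdom c0"
    using charts_cover by blast
  then have c0: "c0 \<in> charts_at A (\<gamma> 0)"
    by (simp add: charts_at_iff)
  have on: "orthonormal_pair (g d (coord d (\<gamma> t))) (Y t d) (Z t d)" if "t \<in> {0..1}" "d \<in> charts_at A (\<gamma> t)" for t d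
    using framingD(3)[OF fr c0] unfolding orthonormal_pair_def
      parallel_inner_product_constant[OF path Y(1) Y(1) that(1) c0 that(2)]
      parallel_inner_product_constant[OF path Y(1) Z(1) that(1) c0 that(2)]
      parallel_inner_product_constant[OF path Z(1) Z(1) that(1) c0 that(2)] Y(2) Z(2) .
  \<comment> \<open>The orientation sign along the path. It is continuous because
    \<open>det2\<close> of an orthonormal pair and \<open>e\<close> are nonzero, and its range is
    finite, so it is constant on the interval.\<close>
  define D where "D t = (let d = SOME d. d \<in> B \<and> \<gamma> t \<in> cdom d in sgn (e * det2 (Y t d) (Z t d)))" for t
  have D: "D t = sgn (e * det2 (Y t d) (Z t d))" if "t \<in> {0..1}" "d \<in> B" "\<gamma> t \<in> cdom d" for t d
  proof -
    define d' where "d' = (SOME d. d \<in> B \<and> \<gamma> t \<in> cdom d)"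
    have d': "d' \<in> B" "\<gamma> t \<in> cdom d'"
      using someI[of "\<lambda>d. d \<in> B \<and> \<gamma> t \<in> cdom d" d] that by (auto simp: d'_def)
    have "det2 (Y t d') (Z t d') = det (jacobian d d' (\<gamma> t)) * det2 (Y t d) (Z t d)"
      by (rule det2_change[OF tan[OF that(1)] B_charts_at[OF that(2,3)] B_charts_at[OF d']])
    then show ?thesis
      using B_pos[OF that(2) d'(1) that(3) d'(2)] by (simp add: D_def d'_def[symmetric] sgn_mult)
  qed
  have "continuous_on {0..1} D"
  proof (rule continuous_on_locally)
    fix t :: real assume t: "t \<in> {0..1}"
    obtain d where d: "d \<in> B" "\<gamma> t \<in> cdom d"
      using B_at[OF path_in[OF path t]] by blast
    then have dA: "d \<in> A" using B_sub by blast
    let ?T = "{t \<in> {0..1}. \<gamma> t \<in> cdom d}"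
    have "continuous_on ?T (\<lambda>t. e * det2 (Y t d) (Z t d))"
      using Y(1) Z(1) dA unfolding det2_def parallel_field_def by (intro continuous_intros) blast+
    moreover have "e * det2 (Y s d) (Z s d) \<noteq> 0" if "s \<in> ?T" for s
      using orthonormal_pair_det2[OF on[of s d]] that dA e_nonzero by (simp add: charts_at_iff)
    ultimately have "continuous_on ?T (\<lambda>t. sgn (e * det2 (Y t d) (Z t d)))"
      by (intro continuous_on_sgn) blast+
    moreover have "D s = sgn (e * det2 (Y s d) (Z s d))" if "s \<in> ?T" for s
      using D[of s d] that d(1) by simp
    ultimately show "\<exists>T h. openin (top_of_set {0..1}) T \<and> t \<in> T \<and> continuous_on T h \<and> (\<forall>x\<in>T. D x = h x)"
      using path_chart_open[OF path dA] t d(2) by blast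
  qed
  moreover have "finite (D ` {0..1})"
  proof (rule finite_subset)
    show "D ` {0..1} \<subseteq> {-1, 0, 1}"
      by (auto simp: D_def Let_def sgn_if)
  qed simp
  ultimately have "D constant_on {0..1}"
    by (intro continuous_finite_range_constant) auto
  then have "D 1 = D 0"
    unfolding constant_on_def by (metis atLeastAtMost_iff order_refl zero_le_one)
  moreover obtain d0 where d0: "d0 \<in> B" "\<gamma> 0 \<in> cdom d0"
    using B_at[OF path_in[OF path, of 0]] by auto
  then have "D 0 = 1"
    using fr D[of 0 d0] unfolding framing_def by (simp add: Y Z)
  moreover obtain d where d: "d \<in> B" "\<gamma> 1 \<in> cdom d"
    using B_at[OF path_in[OF path, of 1]] by auto
  ultimately have "e * det2 (Y 1 d) (Z 1 d) > 0"
    using D[of 1 d] by (simp add: sgn_1_pos[symmetric])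
  then show ?thesis
    using framing_iff[OF tan B_charts_at[OF d] d] on[OF _ B_charts_at[OF d]] by (simp add: Y Z)
qed

end


section \<open>Parallel tensor fields\<close>

lemma sum_section_apply:
  fixes f :: "'i \<Rightarrow> 'a tsection"
  shows "(\<Sum>I\<in>S. f I) q c w = (\<Sum>I\<in>S. f I q c w)"
  by (induction S rule: infinite_finite_induct) auto

lemma tensor_product_h_vec:
  "tensor_product (map (h_vec u v) I) c w = (if length w = length I then hprod I (u c) (v c) w else 0)"
  by (simp add: tensor_product_def hprod_def h_vec_eq_hcomp)

text \<open>Each factor transforms linearly by \<open>J\<close>; expanding the product of sums by
  \<open>sum_words_prod\<close> yields the tensor transformation law.\<close>

lemma hprod_change:
  fixes J :: "real^2^2"
  assumes "length I = k" "length w = k"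
  shows "hprod I (J *v u) (J *v v) w =
    (\<Sum>w' | length w' = k. (\<Prod>j<k. complex_of_real (J $ (w ! j) $ (w' ! j))) * hprod I u v w')"
proof -
  have "hcomp s (J *v u) (J *v v) i = (\<Sum>l\<in>UNIV. complex_of_real (J $ i $ l) * hcomp s u v l)" for s i
    by (simp add: hcomp_def matrix_vector_mult_def sum_2 algebra_simps)
  then have "hprod I (J *v u) (J *v v) w =
      (\<Prod>m<k. \<Sum>l\<in>UNIV. complex_of_real (J $ (w ! m) $ l) * hcomp (I ! m) u v l)"
    by (simp add: hprod_def assms(1))
  also have "\<dots> = (\<Sum>w' | length w' = k. \<Prod>m<k. complex_of_real (J $ (w ! m) $ (w' ! m)) * hcomp (I ! m) u v (w' ! m))"
    by (rule sum_words_prod[symmetric])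
  finally show ?thesis
    by (simp add: hprod_def assms(1) prod.distrib)
qed

lemma tensor_fibreI:
  assumes "\<And>c w. c \<notin> charts_at A q \<or> length w \<noteq> k \<Longrightarrow> t c w = 0"
    and "\<And>c d w. c \<in> charts_at A q \<Longrightarrow> d \<in> charts_at A q \<Longrightarrow> length w = k \<Longrightarrow>
      t d w = (\<Sum>u | length u = k. (\<Prod>j<k. complex_of_real (jacobian c d q $ (w ! j) $ (u ! j))) * t c u)"
  shows "t \<in> tensor_fibre A k q"
  unfolding tensor_fibre_def mem_Collect_eq using assms by blast

lemma tensor_fibreD:
  assumes "t \<in> tensor_fibre A k q"
  shows "c \<notin> charts_at A q \<or> length w \<noteq> k \<Longrightarrow> t c w = 0"
    and "c \<in> charts_at A q \<Longrightarrow> d \<in> charts_at A q \<Longrightarrow> length w = k \<Longrightarrow>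
      t d w = (\<Sum>u | length u = k. (\<Prod>j<k. complex_of_real (jacobian c d q $ (w ! j) $ (u ! j))) * t c u)"
  using assms unfolding tensor_fibre_def mem_Collect_eq by blast+

text \<open>The transformation law recovers the components in every chart around \<open>q\<close>
  from those in \<open>c\<close>, and the normalisation fixes all others.\<close>

lemma tensor_fibre_eqI:
  assumes t: "t \<in> tensor_fibre A k q" and t': "t' \<in> tensor_fibre A k q" and c: "c \<in> charts_at A q"
    and eq: "\<And>w. length w = k \<Longrightarrow> t c w = t' c w"
  shows "t = t'"
proof (intro ext)
  fix d w
  show "t d w = t' d w"
  proof (cases "d \<in> charts_at A q \<and> length w = k")
    case True
    then have d: "d \<in> charts_at A q" and w: "length w = k" by auto
    show ?thesis
      unfolding tensor_fibreD(2)[OF t c d w] tensor_fibreD(2)[OF t' c d w] by (simp add: eq)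
  next
    case False
    then have F: "d \<notin> charts_at A q \<or> length w \<noteq> k" by blast
    show ?thesis
      unfolding tensor_fibreD(1)[OF t F] tensor_fibreD(1)[OF t' F] ..
  qed
qed

section \<open>Linear structure of the parallel sections\<close>

lemma parallel_sectionsD:
  assumes "s \<in> parallel_sections M A g k"
  shows "q \<in> topspace M \<Longrightarrow> s q \<in> tensor_fibre A k q"
    and "q \<notin> topspace M \<Longrightarrow> s q = 0"
    and "c \<in> A \<Longrightarrow> length w = k \<Longrightarrow> smooth_on (cimg c) (local_rep s c w)"
    and "c \<in> A \<Longrightarrow> x \<in> cimg c \<Longrightarrow> length w = k \<Longrightarrow> covariant_derivative g s c j w x = 0"
  using assms unfolding parallel_sections_def global_sections_def by blast+

lemma local_rep_add: "local_rep (s + t) c w = (\<lambda>x. local_rep s c w x + local_rep t c w x)"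
  by (simp add: local_rep_def fun_eq_iff)

lemma local_rep_zero: "local_rep 0 c w = (\<lambda>x. 0)"
  by (simp add: local_rep_def fun_eq_iff)

lemma local_rep_scale: "local_rep (section_scale a s) c w = (\<lambda>x. a * local_rep s c w x)"
  by (simp add: local_rep_def section_scale_def fun_eq_iff)

lemma tensor_fibre_add:
  assumes t: "t \<in> tensor_fibre A k q" and t': "t' \<in> tensor_fibre A k q"
  shows "t + t' \<in> tensor_fibre A k q"
proof (rule tensor_fibreI)
  show "(t + t') c w = 0" if "c \<notin> charts_at A q \<or> length w \<noteq> k" for c w
    by (simp add: tensor_fibreD(1)[OF t that] tensor_fibreD(1)[OF t' that])
  show "(t + t') d w = (\<Sum>u | length u = k.
      (\<Prod>j<k. complex_of_real (jacobian c d q $ (w ! j) $ (u ! j))) * (t + t') c u)"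
    if "c \<in> charts_at A q" "d \<in> charts_at A q" "length w = k" for c d w
    unfolding plus_fun_apply tensor_fibreD(2)[OF t that] tensor_fibreD(2)[OF t' that]
    by (simp add: sum.distrib ring_distribs)
qed

lemma tensor_fibre_scale:
  assumes t: "t \<in> tensor_fibre A k q"
  shows "(\<lambda>c w. a * t c w) \<in> tensor_fibre A k q"
proof (rule tensor_fibreI)
  show "a * t c w = 0" if "c \<notin> charts_at A q \<or> length w \<noteq> k" for c w
    by (simp add: tensor_fibreD(1)[OF t that])
  show "a * t d w = (\<Sum>u | length u = k.
      (\<Prod>j<k. complex_of_real (jacobian c d q $ (w ! j) $ (u ! j))) * (a * t c u))"
    if "c \<in> charts_at A q" "d \<in> charts_at A q" "length w = k" for c d w
    unfolding tensor_fibreD(2)[OF t that] by (simp add: sum_distrib_left mult_ac)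
qed

lemma tensor_fibre_zero: "0 \<in> tensor_fibre A k q"
  by (rule tensor_fibreI) simp_all

context surface
begin

lemma subspace_parallel_sections: "sections.subspace (parallel_sections M A g k)"
proof (rule sections.subspaceI)
  show "0 \<in> parallel_sections M A g k"
    by (simp add: parallel_sections_def global_sections_def tensor_fibre_zero covariant_derivative_def
        local_rep_zero)
next
  fix s t assume s: "s \<in> parallel_sections M A g k" and t: "t \<in> parallel_sections M A g k"
  note sD = parallel_sectionsD[OF s] and tD = parallel_sectionsD[OF t]
  have "covariant_derivative g (s + t) c j w x = 0" if c: "c \<in> A" "x \<in> cimg c" "length w = k" for c j w x
  proof -
    have "partial j (local_rep (s + t) c w) x = partial j (local_rep s c w) x + partial j (local_rep t c w) x"
      unfolding local_rep_add
      by (intro partial_add smooth_on_differentiable[OF sD(3)] smooth_on_differentiable[OF tD(3)] c)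
    then have "covariant_derivative g (s + t) c j w x = covariant_derivative g s c j w x + covariant_derivative g t c j w x"
      by (simp add: covariant_derivative_def local_rep_add sum.distrib ring_distribs)
    then show ?thesis
      using sD(4) tD(4) c by simp
  qed
  moreover have "smooth_on (cimg c) (local_rep (s + t) c w)" if "c \<in> A" "length w = k" for c w
    unfolding local_rep_add using that by (intro smooth_on_add chartD sD(3) tD(3))
  moreover have "(s + t) q \<in> tensor_fibre A k q" if "q \<in> topspace M" for q
    using tensor_fibre_add[OF sD(1)[OF that] tD(1)[OF that]] by (simp add: plus_fun_def)
  ultimately show "s + t \<in> parallel_sections M A g k"
    using sD(2) tD(2) by (simp add: parallel_sections_def global_sections_def)
next
  fix a s assume s: "s \<in> parallel_sections M A g k"
  note sD = parallel_sectionsD[OF s]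
  have "covariant_derivative g (section_scale a s) c j w x = 0" if c: "c \<in> A" "x \<in> cimg c" "length w = k" for c j w x
  proof -
    have "partial j (local_rep (section_scale a s) c w) x = a * partial j (local_rep s c w) x"
      unfolding local_rep_scale by (intro partial_cmult smooth_on_differentiable[OF sD(3)] c)
    then have "covariant_derivative g (section_scale a s) c j w x = a * covariant_derivative g s c j w x"
      by (simp add: covariant_derivative_def local_rep_scale sum_distrib_left ring_distribs mult_ac)
    then show ?thesis
      using sD(4) c by simp
  qed
  moreover have "smooth_on (cimg c) (local_rep (section_scale a s) c w)" if "c \<in> A" "length w = k" for c w
    unfolding local_rep_scale using that by (intro smooth_on_mult smooth_on_const chartD sD(3))
  moreover have "section_scale a s q \<in> tensor_fibre A k q" if "q \<in> topspace M" for q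
    unfolding section_scale_def using that by (intro tensor_fibre_scale sD(1))
  moreover have "section_scale a s q = 0" if "q \<notin> topspace M" for q
    using sD(2)[OF that] by (simp add: section_scale_def fun_eq_iff)
  ultimately show "section_scale a s \<in> parallel_sections M A g k"
    by (simp add: parallel_sections_def global_sections_def)
qed

text \<open>One coordinate plane suffices: if the tensor vanished, its sectional curvature there
  would be 0 instead of \<open>K\<close>.\<close>

lemma curvature_nonzero:
  assumes "constant_sectional_curvature A g K" "K \<noteq> 0" "c \<in> A" "x \<in> cimg c"
  shows "\<exists>l i j m. riemann g c x l i j m \<noteq> 0"
proof (rule ccontr)
  assume "\<not> ?thesis"
  then have zero: "curvature_operator g c x X Y Z = 0" for X Y Z
    by (simp add: curvature_operator_def vec_eq_iff)
  have "axis 1 1 \<noteq> (axis 2 1 :: real^2)"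
    by (simp add: axis_eq_axis)
  moreover have "independent {axis 1 1, axis 2 1 :: real^2}"
    by (rule independent_mono[OF independent_Basis]) (auto simp: Basis_vec_def)
  ultimately have "sectional_curvature g c x (axis 1 1) (axis 2 1) = K"
    using assms unfolding constant_sectional_curvature_def by blast
  then show False
    using assms(2) by (simp add: sectional_curvature_def zero ip_def)
qed

end

context oriented_surface
begin

text \<open>The value at \<open>q\<close> does not depend on the chosen oriented frame when \<open>I\<close> is balanced.\<close>

definition frame_section :: "sign list \<Rightarrow> 'a tsection" where
  "frame_section I q =
     (if q \<in> topspace M
      then let f = SOME f. framing q (fst f) (snd f) in tensor_product (map (h_vec (fst f) (snd f)) I)
      else 0)"

lemma frame_section_eq:
  assumes fr: "framing q u v" and q: "q \<in> topspace M" and I: "I \<in> balanced_words k" and k: "k > 0"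
  shows "frame_section I q = tensor_product (map (h_vec u v) I)"
proof -
  define f where "f = (SOME f. framing q (fst f) (snd f))"
  have f: "framing q (fst f) (snd f)"
    unfolding f_def by (rule someI[of _ "(u, v)"]) (simp add: fr)
  \<comment> \<open>At charts around \<open>q\<close> a balanced word does not see the frame; at all
    other charts both frames have zero components.\<close>
  have "hprod I (fst f c) (snd f c) w = hprod I (u c) (v c) w" for c w
  proof (cases "c \<in> charts_at A q")
    case True
    show ?thesis
      by (rule hprod_framing_unique[OF f fr q True I])
  next
    case False
    then show ?thesis
      using tangentD(2)[OF framingD(1)[OF f]] tangentD(2)[OF framingD(2)[OF f]]
        tangentD(2)[OF framingD(1)[OF fr]] tangentD(2)[OF framingD(2)[OF fr]] by simp
  qed
  then show ?thesis
    using q by (simp add: frame_section_def f_def[symmetric] Let_def fun_eq_iff tensor_product_h_vec)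
qed

lemma frame_section_hprod:
  assumes "framing q u v" "q \<in> topspace M" "I \<in> balanced_words k" "k > 0" "length w = k"
  shows "frame_section I q c w = hprod I (u c) (v c) w"
  using assms frame_section_eq[OF assms(1-4)] by (simp add: tensor_product_h_vec balanced_words_def)

lemma frame_section_fibre:
  assumes q: "q \<in> topspace M" and I: "I \<in> balanced_words k" and k: "k > 0"
  shows "frame_section I q \<in> tensor_fibre A k q"
proof -
  obtain u v where fr: "framing q u v"
    using framing_exists[OF q] by blast
  have len: "length I = k"
    using I by (simp add: balanced_words_def)
  note tan = framingD(1,2)[OF fr]
  have eq: "frame_section I q c w = (if length w = k then hprod I (u c) (v c) w else 0)" for c w
    by (simp add: frame_section_eq[OF fr q I k] tensor_product_h_vec len)
  \<comment> \<open>Positivity of \<open>k\<close> matters here: an empty product would be 1 even at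
    charts not containing \<open>q\<close>, against the normalisation.\<close>
  have "hprod I (u c) (v c) w = 0" if "c \<notin> charts_at A q" for c w
    using tangentD(2)[OF tan(1) that] tangentD(2)[OF tan(2) that] k
    by (auto simp: hprod_def hcomp_def len)
  moreover have "hprod I (u d) (v d) w = (\<Sum>w' | length w' = k.
      (\<Prod>j<k. complex_of_real (jacobian c d q $ (w ! j) $ (w' ! j))) * hprod I (u c) (v c) w')"
    if "c \<in> charts_at A q" "d \<in> charts_at A q" "length w = k" for c d w
    unfolding tangentD(1)[OF tan(1) that(1,2)] tangentD(1)[OF tan(2) that(1,2)]
    by (rule hprod_change[OF len that(3)])
  ultimately show ?thesis
    by (intro tensor_fibreI) (auto simp: eq)
qed

lemma local_frame_section:
  assumes c: "c \<in> A" and q: "q \<in> cdom c" and k: "k > 0"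
  obtains N \<sigma> where "open N" "connected N" "coord c q \<in> N" "N \<subseteq> cimg c" "gram_frame g c N \<sigma>"
    "\<And>x I w. x \<in> N \<Longrightarrow> I \<in> balanced_words k \<Longrightarrow> length w = k \<Longrightarrow>
        local_rep (frame_section I) c w x = hprod I (gram_frame.fu g c x) (gram_frame.fv g c \<sigma> x) w"
proof (rule local_framing[OF c q])
  fix N \<sigma>
  assume N: "open N" "connected N" "coord c q \<in> N" "N \<subseteq> cimg c" "gram_frame g c N \<sigma>"
    and fr: "\<And>x. x \<in> N \<Longrightarrow> framing (param c x) (push A (param c x) c (gram_frame.fu g c x))
        (push A (param c x) c (gram_frame.fv g c \<sigma> x))"
  have "local_rep (frame_section I) c w x = hprod I (gram_frame.fu g c x) (gram_frame.fv g c \<sigma> x) w"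
    if "x \<in> N" "I \<in> balanced_words k" "length w = k" for x I w
  proof -
    have "x \<in> cimg c"
      using N(4) that(1) by blast
    then have "c \<in> charts_at A (param c x)" "param c x \<in> topspace M"
      using c chartD(3)[OF c] param_in[of x c] by (auto simp: charts_at_iff)
    then show ?thesis
      using frame_section_hprod[OF fr[OF that(1)] _ that(2) k that(3)] by (simp add: local_rep_def push_self)
  qed
  then show thesis
    using that N by blast
qed

text \<open>Near each point the section is a product in the Gram-Schmidt frame of the chart.
  Smoothness is that of explicit formulas, and the covariant derivative carries the factor
  \<open>weight I\<close>, which is 0.\<close>

lemma frame_section_parallel:
  assumes I: "I \<in> balanced_words k" and k: "k > 0"
  shows "frame_section I \<in> parallel_sections M A g k"
proof -
  have len: "length I = k" and wt: "weight I = 0"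
    using I by (auto simp: balanced_words_iff)
  have loc: "\<exists>N. open N \<and> x \<in> N \<and> smooth_on N (local_rep (frame_section I) c w)"
    and par: "covariant_derivative g (frame_section I) c j w x = 0"
    if c: "c \<in> A" and x: "x \<in> cimg c" and w: "length w = k" for c w j x
  proof -
    obtain N \<sigma> where N: "open N" "coord c (param c x) \<in> N" "N \<subseteq> cimg c" "gram_frame g c N \<sigma>"
      and eq: "\<And>x I w. x \<in> N \<Longrightarrow> I \<in> balanced_words k \<Longrightarrow> length w = k \<Longrightarrow>
        local_rep (frame_section I) c w x = hprod I (gram_frame.fu g c x) (gram_frame.fv g c \<sigma> x) w"
      by (rule local_frame_section[OF c param_in[OF x] k]) blast
    interpret gram_frame g c N \<sigma>
      by (rule N(4))
    have xN: "x \<in> N"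
      using N(2) coord_param[OF x] by simp
    have "smooth_on N (\<lambda>y. hprod I (fu y) (fv y) w)"
      unfolding hprod_def by (intro smooth_on_prod smooth_hf N(1))
    then have "smooth_on N (local_rep (frame_section I) c w)"
      by (simp only: smooth_on_cong[of N "local_rep (frame_section I) c w", OF N(1) eq[OF _ I w]])
    then show "\<exists>N. open N \<and> x \<in> N \<and> smooth_on N (local_rep (frame_section I) c w)"
      using N(1) xN by blast
    have "partial j (local_rep (frame_section I) c w) x = partial j (\<lambda>y. hprod I (fu y) (fv y) w) x"
      by (rule partial_cong[OF N(1) xN eq[OF _ I w]])
    moreover have "local_rep (frame_section I) c (w[m := l]) x = hprod I (fu x) (fv x) (w[m := l])" for m l
      using w by (intro eq[OF xN I]) simp
    ultimately show "covariant_derivative g (frame_section I) c j w x = 0"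
      using covariant_derivative_hprod[OF xN, of w I j] w len wt
      by (simp add: covariant_derivative_def)
  qed
  have "smooth_on (cimg c) (local_rep (frame_section I) c w)" if "c \<in> A" "length w = k" for c w
    by (rule smooth_on_local) (rule loc[OF that(1) _ that(2)])
  moreover have "frame_section I q = 0" if "q \<notin> topspace M" for q
    using that by (simp add: frame_section_def)
  ultimately show ?thesis
    using frame_section_fibre[OF _ I k] par
    unfolding parallel_sections_def global_sections_def mem_Collect_eq by blast
qed

lemma frame_section_independent_at:
  assumes q: "q \<in> topspace M" and k: "k > 0" and S: "S \<subseteq> balanced_words k" and I: "I \<in> S"
    and zero: "\<And>c w. (\<Sum>I\<in>S. a I * frame_section I q c w) = 0"
  shows "a I = 0"
proof -
  obtain u v where fr: "framing q u v"
    using framing_exists[OF q] by blast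
  obtain c where c: "c \<in> charts_at A q"
    using q charts_cover charts_at_iff by blast
  have "(\<Sum>I\<in>S. a I * hprod I (u c) (v c) w) = 0" if "length w = k" for w
  proof -
    have "(\<Sum>I\<in>S. a I * hprod I (u c) (v c) w) = (\<Sum>I\<in>S. a I * frame_section I q c w)"
      using S by (intro sum.cong refl) (simp add: frame_section_hprod[OF fr q subsetD[OF S] k that])
    with zero show ?thesis by simp
  qed
  then show ?thesis
    using hprod_independent[OF metric_sym[OF c] framingD(3)[OF fr c] _ _ I, of k a] S
    by (auto simp: balanced_words_def)
qed

section \<open>Unique continuation and the basis property\<close>

abbreviation comb :: "nat \<Rightarrow> (sign list \<Rightarrow> complex) \<Rightarrow> 'a tsection" where
  "comb k a \<equiv> (\<Sum>I\<in>balanced_words k. section_scale (a I) (frame_section I))"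

lemma comb_apply: "comb k a q c w = (\<Sum>I\<in>balanced_words k. a I * frame_section I q c w)"
  by (simp add: sum_section_apply section_scale_def)

lemma comb_parallel: "k > 0 \<Longrightarrow> comb k a \<in> parallel_sections M A g k"
  using subspace_parallel_sections
  by (intro sections.subspace_sum sections.subspace_scale frame_section_parallel)

text \<open>Independence at the single point \<open>q\<close> already determines all
  coefficients.\<close>

lemma comb_eqD:
  assumes "q \<in> topspace M" "k > 0" "comb k a q = comb k b q"
  shows "comb k a = comb k b"
proof -
  have "a I = b I" if "I \<in> balanced_words k" for I
  proof -
    have "(\<Sum>I\<in>balanced_words k. (a I - b I) * frame_section I q c w) = 0" for c w
      using assms(3) comb_apply[of a k q c w] comb_apply[of b k q c w]
      by (simp add: sum_subtractf left_diff_distrib)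
    from frame_section_independent_at[OF assms(1,2) order_refl that this] show ?thesis
      by simp
  qed
  then show ?thesis by simp
qed

text \<open>\<open>parallel_local_form\<close> compares components in one chart; as both sides lie
  in the tensor fibre, this is already equality of tensors.\<close>

lemma parallel_section_locally_comb:
  assumes s: "s \<in> parallel_sections M A g k" and k: "k > 0" and q: "q \<in> topspace M"
    and curved: "\<And>c x. c \<in> A \<Longrightarrow> x \<in> cimg c \<Longrightarrow> \<exists>l i j m. riemann g c x l i j m \<noteq> 0"
  shows "\<exists>W a. openin M W \<and> q \<in> W \<and> (\<forall>r\<in>W. s r = comb k a r)"
proof -
  obtain c where c: "c \<in> A" "q \<in> cdom c"
    using charts_cover q by blast
  obtain N \<sigma> where N: "open N" "connected N" "coord c q \<in> N" "N \<subseteq> cimg c" "gram_frame g c N \<sigma>"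
      and eq: "\<And>x I w. x \<in> N \<Longrightarrow> I \<in> balanced_words k \<Longrightarrow> length w = k \<Longrightarrow>
        local_rep (frame_section I) c w x = hprod I (gram_frame.fu g c x) (gram_frame.fv g c \<sigma> x) w"
    by (rule local_frame_section[OF c k]) blast
  interpret gram_frame g c N \<sigma>
    by (rule N(5))
  obtain a where a: "\<And>x w. x \<in> N \<Longrightarrow> length w = k \<Longrightarrow>
      local_rep s c w x = (\<Sum>I\<in>balanced_words k. a I * hprod I (fu x) (fv x) w)"
  proof (rule parallel_local_form[OF N(2), of k "local_rep s c"])
    show "smooth_on N (local_rep s c w)" if "length w = k" for w
      by (rule smooth_on_subset[OF parallel_sectionsD(3)[OF s c(1) that] N(4)])
    show "partial j (local_rep s c w) x + (\<Sum>m<length w. \<Sum>l\<in>UNIV. complex_of_real (\<Gamma> x (w ! m) j l) * local_rep s c (w[m := l]) x) = 0"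
      if "x \<in> N" "length w = k" for x j w
      using parallel_sectionsD(4)[OF s c(1) _ that(2), of x j] N(4) that(1)
      by (auto simp: covariant_derivative_def)
    show "\<exists>l i j m. riemann g c x l i j m \<noteq> 0" if "x \<in> N" for x
      by (rule curved[OF c(1) subsetD[OF N(4) that]])
  qed blast
  let ?W = "{r \<in> cdom c. coord c r \<in> N}"
  have "s r = comb k a r" if r: "r \<in> ?W" for r
  proof (rule tensor_fibre_eqI)
    have "r \<in> topspace M"
      using r chartD(3)[OF c(1)] by blast
    then show "s r \<in> tensor_fibre A k r" "comb k a r \<in> tensor_fibre A k r"
      using parallel_sectionsD(1)[OF s] parallel_sectionsD(1)[OF comb_parallel[OF k]] by blast+
    show "c \<in> charts_at A r"
      using r c(1) by (simp add: charts_at_iff)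
    show "s r c w = comb k a r c w" if "length w = k" for w
    proof -
      have x: "coord c r \<in> N" and p: "param c (coord c r) = r"
        using r param_coord[OF c(1)] by auto
      show ?thesis
        unfolding comb_apply using a[OF x that] eq[OF x _ that] by (simp add: local_rep_def p)
    qed
  qed
  moreover have "openin M ?W"
    by (rule openin_coord_preimage[OF c(1) N(1)])
  moreover have "q \<in> ?W"
    using c(2) N(3) by simp
  ultimately show ?thesis by blast
qed

lemma parallel_section_comb:
  assumes conn: "connected_space M" and s: "s \<in> parallel_sections M A g k" and k: "k > 0"
    and curved: "\<And>c x. c \<in> A \<Longrightarrow> x \<in> cimg c \<Longrightarrow> \<exists>l i j m. riemann g c x l i j m \<noteq> 0"
    and p: "p \<in> topspace M"
  shows "\<exists>a. s = comb k a"
proof -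
  have loc: "\<exists>W b. openin M W \<and> q \<in> W \<and> (\<forall>r\<in>W. s r = comb k b r)" if "q \<in> topspace M" for q
    by (rule parallel_section_locally_comb[OF s k that curved])
  obtain W0 a where a: "p \<in> W0" "\<forall>r\<in>W0. s r = comb k a r"
    using loc[OF p] by blast
  define T where "T = {q \<in> topspace M. s q = comb k a q}"
  \<comment> \<open>If the combination valid near \<open>q\<close> meets \<open>T\<close> at one
    point, \<open>comb_eqD\<close> identifies it with the one found at \<open>p\<close>. So a
    neighbourhood of \<open>q\<close> lies in \<open>T\<close> or misses it, which makes
    \<open>T\<close> open and closed.\<close>
  have nbhd: "\<exists>W. openin M W \<and> q \<in> W \<and> (W \<subseteq> T \<or> W \<inter> T = {})" if q: "q \<in> topspace M" for q
  proof -
    obtain W b where W: "openin M W" "q \<in> W" "\<forall>r\<in>W. s r = comb k b r"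
      using loc[OF q] by blast
    have "W \<subseteq> T" if "r \<in> W" "r \<in> T" for r
    proof -
      have "comb k b r = comb k a r"
        using W(3) that by (simp add: T_def)
      then have "comb k b = comb k a"
        using that by (intro comb_eqD[OF _ k]) (auto simp: T_def)
      then show ?thesis
        using W(3) openin_subset[OF W(1)] by (auto simp: T_def)
    qed
    then show ?thesis
      using W(1,2) by blast
  qed
  have "openin M T"
    unfolding openin_subopen[of M T] using nbhd by (fastforce simp: T_def)
  moreover have "openin M (topspace M - T)"
    unfolding openin_subopen[of M "topspace M - T"]
  proof
    fix q assume q: "q \<in> topspace M - T"
    then obtain W where "openin M W" "q \<in> W" "W \<subseteq> T \<or> W \<inter> T = {}"
      using nbhd by blast
    then show "\<exists>W. openin M W \<and> q \<in> W \<and> W \<subseteq> topspace M - T"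
      using q openin_subset by blast
  qed
  ultimately have "T = {} \<or> T = topspace M"
    using conn unfolding connected_space_clopen_in closedin_def T_def by blast
  moreover have "p \<in> T"
    using a p by (simp add: T_def)
  ultimately have "s q = comb k a q" if "q \<in> topspace M" for q
    using that by (auto simp: T_def)
  moreover have "s q = comb k a q" if "q \<notin> topspace M" for q
    using parallel_sectionsD(2)[OF s that] parallel_sectionsD(2)[OF comb_parallel[OF k] that] by simp
  ultimately have "s = comb k a"
    by blast
  then show ?thesis
    by (rule exI[of _ a])
qed

lemma frame_sections_basis:
  assumes conn: "connected_space M" and k: "k > 0" and p: "p \<in> topspace M"
    and curved: "\<And>c x. c \<in> A \<Longrightarrow> x \<in> cimg c \<Longrightarrow> \<exists>l i j m. riemann g c x l i j m \<noteq> 0"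
  shows "sections.independent (frame_section ` balanced_words k)"
    and "sections.span (frame_section ` balanced_words k) = parallel_sections M A g k"
proof -
  have fin: "finite (balanced_words k)"
    by (rule finite_subset[OF _ finite_words[of k]]) (auto simp: balanced_words_def)
  \<comment> \<open>Independence concerns the set of sections, so distinct words must give distinct
    sections before sums over words and over sections can be exchanged.\<close>
  have inj: "inj_on frame_section (balanced_words k)"
  proof (rule inj_onI, rule ccontr)
    fix I J assume IJ: "I \<in> balanced_words k" "J \<in> balanced_words k" "frame_section I = frame_section J" "I \<noteq> J"
    \<comment> \<open>Equal sections would give a vanishing combination with coefficients 1 and -1
      on {I, J}; the conditional is the coefficient at \<open>I\<close>.\<close>
    have "(if I = I then 1 else - 1 :: complex) = 0"
      by (rule frame_section_independent_at[OF p k, of "{I, J}" I "\<lambda>L. if L = I then 1 else - 1"])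
        (use IJ in auto)
    then show False by simp
  qed
  show "sections.independent (frame_section ` balanced_words k)"
  proof
    assume "sections.dependent (frame_section ` balanced_words k)"
    then obtain b where b: "\<exists>t\<in>frame_section ` balanced_words k. b t \<noteq> 0"
      "(\<Sum>t\<in>frame_section ` balanced_words k. section_scale (b t) t) = 0"
      using sections.dependent_finite[of "frame_section ` balanced_words k"] fin by auto
    then have "comb k (\<lambda>I. b (frame_section I)) = 0"
      by (simp add: sum.reindex[OF inj])
    then have "(\<Sum>I\<in>balanced_words k. b (frame_section I) * frame_section I p c w) = 0" for c w
      using comb_apply[of "\<lambda>I. b (frame_section I)" k p c w] by simp
    then have "b (frame_section I) = 0" if "I \<in> balanced_words k" for I
      using frame_section_independent_at[OF p k order_refl that, of "\<lambda>I. b (frame_section I)"] by blast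
    with b(1) show False by blast
  qed
  show "sections.span (frame_section ` balanced_words k) = parallel_sections M A g k"
  proof
    show "sections.span (frame_section ` balanced_words k) \<subseteq> parallel_sections M A g k"
      using frame_section_parallel[OF _ k] subspace_parallel_sections
      by (intro sections.span_minimal) auto
    show "parallel_sections M A g k \<subseteq> sections.span (frame_section ` balanced_words k)"
    proof
      fix s assume "s \<in> parallel_sections M A g k"
      then obtain a where s: "s = comb k a"
        using parallel_section_comb[OF conn _ k curved p] by blast
      show "s \<in> sections.span (frame_section ` balanced_words k)"
        unfolding s by (intro sections.span_sum sections.span_scale sections.span_base imageI)
    qed
  qed
qed

end

theorem proposition3p10:
  fixes M :: "'a topology" and A :: "'a chart set" and g :: "'a metric_tensor"
    and K :: real and k :: nat and p :: 'a and V :: "'a set"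
    and e1 e2 :: "'a tvec" and X1 X2 :: "'a \<Rightarrow> 'a tvec" and path_to :: "'a \<Rightarrow> real \<Rightarrow> 'a"
  assumes "riemannian_surface M A g"
    and "connected_space M"
    and "orientable_surface M A"
    and "geodesically_complete M A g"
    and "constant_sectional_curvature A g K" and "K \<noteq> 0"
    and "p \<in> topspace M"
    and "orthonormal_basis_at A g p e1 e2"
    and "openin M V" and "p \<in> V"
    and "\<And>q. q \<in> V \<Longrightarrow> piecewise_C1_path M A (path_to q) \<and> path_to q 0 = p \<and> path_to q 1 = q"
    and "\<And>q. q \<in> V \<Longrightarrow> parallel_transport A g (path_to q) e1 (X1 q)"
    and "\<And>q. q \<in> V \<Longrightarrow> parallel_transport A g (path_to q) e2 (X2 q)"
    and "k > 0"
  shows "(\<forall>I\<in>balanced_words k. \<exists>!s. s \<in> parallel_sections M A g k \<and>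
            (\<forall>q\<in>V. s q = h_tensor X1 X2 I q)) \<and>
         (let B = {s \<in> parallel_sections M A g k.
                     \<exists>I\<in>balanced_words k. \<forall>q\<in>V. s q = h_tensor X1 X2 I q}
          in sections.independent B \<and> sections.span B = parallel_sections M A g k)"
proof -
  interpret surface M A g
    by unfold_locales (rule assms(1))
  obtain B where B: "B \<subseteq> A" "(\<Union>c\<in>B. cdom c) = topspace M"
    and B_det: "\<forall>c\<in>B. \<forall>d\<in>B. \<forall>q\<in>cdom c \<inter> cdom d. det (jacobian c d q) > 0"
    using assms(3) unfolding orientable_surface_def by (elim exE conjE)
  obtain d where d: "d \<in> B" "p \<in> cdom d"
    using B(2) assms(7) by blast
  then have dp: "d \<in> charts_at A p"
    using B(1) charts_at_iff by blast
  \<comment> \<open>The determinant of the given basis itself makes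
    \<open>e * det2 (e1 d) (e2 d)\<close> a square, so \<open>e1\<close>, \<open>e2\<close> is a
    framing whichever orientation \<open>B\<close> carries.\<close>
  define e where "e = det2 (e1 d) (e2 d)"
  have on: "orthonormal_pair (g d (coord d p)) (e1 d) (e2 d)"
    and tan: "e1 \<in> tangent_space A p" "e2 \<in> tangent_space A p"
    using assms(8) dp unfolding orthonormal_basis_at_alt by blast+
  have e: "e \<noteq> 0"
    unfolding e_def by (rule orthonormal_pair_det2[OF on])
  interpret oriented_surface M A g B e
  proof unfold_locales
    show "det (jacobian c d q) > 0" if "c \<in> B" "d \<in> B" "q \<in> cdom c" "q \<in> cdom d" for c d q
      by (rule B_det[THEN bspec, THEN bspec, THEN bspec, OF that(1,2) IntI[OF that(3,4)]])
  qed (fact B e)+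
  have "e * e > 0"
    using e zero_less_power2[of e] by (simp add: power2_eq_square)
  then have "framing p e1 e2"
    using framing_iff[OF tan dp d] on by (simp add: e_def[symmetric])
  then have fr: "framing q (X1 q) (X2 q)" if "q \<in> V" for q
    using transport_framing[of "path_to q" e1 "X1 q" e2 "X2 q"] assms(11-13)[OF that] by simp
  have VM: "q \<in> topspace M" if "q \<in> V" for q
    using openin_subset[OF assms(9)] that by blast
  have h: "h_tensor X1 X2 I q = frame_section I q" if "q \<in> V" "I \<in> balanced_words k" for q I
    using frame_section_eq[OF fr[OF that(1)] VM[OF that(1)] that(2) assms(14)] by (simp add: h_tensor_def)
  have curved: "\<And>c x. c \<in> A \<Longrightarrow> x \<in> cimg c \<Longrightarrow> \<exists>l i j m. riemann g c x l i j m \<noteq> 0"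
    by (rule curvature_nonzero[OF assms(5,6)])
  \<comment> \<open>Both sections are combinations of frame sections with constant coefficients, so
    their value at \<open>p\<close> decides.\<close>
  have unique: "s = t" if st: "s \<in> parallel_sections M A g k" "t \<in> parallel_sections M A g k" "s p = t p" for s t
  proof -
    have ex: "\<exists>a. s = comb k a" if "s \<in> parallel_sections M A g k" for s
      by (rule parallel_section_comb[OF assms(2) that assms(14) _ assms(7)]) (rule curved)
    obtain a where a: "s = comb k a"
      using ex[OF st(1)] by (elim exE)
    obtain b where b: "t = comb k b"
      using ex[OF st(2)] by (elim exE)
    show ?thesis
      using st(3) unfolding a b by (rule comb_eqD[OF assms(7,14)])
  qed
  \<comment> \<open>This yields existence and uniqueness of the extension at once, and it turns the
    set in the statement into the image of \<open>frame_section\<close>.\<close>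
  have char: "s \<in> parallel_sections M A g k \<and> (\<forall>q\<in>V. s q = h_tensor X1 X2 I q) \<longleftrightarrow> s = frame_section I"
    if I: "I \<in> balanced_words k" for s I
  proof
    assume s: "s \<in> parallel_sections M A g k \<and> (\<forall>q\<in>V. s q = h_tensor X1 X2 I q)"
    show "s = frame_section I"
    proof (rule unique)
      show "s \<in> parallel_sections M A g k" "frame_section I \<in> parallel_sections M A g k"
        using s frame_section_parallel[OF I assms(14)] by simp_all
      show "s p = frame_section I p"
        using s h[OF assms(10) I] assms(10) by simp
    qed
  next
    assume "s = frame_section I"
    then show "s \<in> parallel_sections M A g k \<and> (\<forall>q\<in>V. s q = h_tensor X1 X2 I q)"
      using frame_section_parallel[OF I assms(14)] h[OF _ I] by simp
  qed
  have "s \<in> parallel_sections M A g k \<and> (\<exists>I\<in>balanced_words k. \<forall>q\<in>V. s q = h_tensor X1 X2 I q) \<longleftrightarrow>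
      s \<in> frame_section ` balanced_words k" for s
  proof -
    have "s \<in> parallel_sections M A g k \<and> (\<exists>I\<in>balanced_words k. \<forall>q\<in>V. s q = h_tensor X1 X2 I q) \<longleftrightarrow>
        (\<exists>I\<in>balanced_words k. s \<in> parallel_sections M A g k \<and> (\<forall>q\<in>V. s q = h_tensor X1 X2 I q))"
      by (simp only: bex_simps)
    also have "\<dots> \<longleftrightarrow> (\<exists>I\<in>balanced_words k. s = frame_section I)"
      by (rule bex_cong[OF refl char])
    finally show ?thesis
      by (simp only: image_iff)
  qed
  then have "{s \<in> parallel_sections M A g k. \<exists>I\<in>balanced_words k. \<forall>q\<in>V. s q = h_tensor X1 X2 I q} =
      frame_section ` balanced_words k"
    by (intro set_eqI) (simp only: mem_Collect_eq)
  moreover have "\<exists>!s. s \<in> parallel_sections M A g k \<and> (\<forall>q\<in>V. s q = h_tensor X1 X2 I q)"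
    if "I \<in> balanced_words k" for I
    unfolding char[OF that] by (rule ex1I[of _ "frame_section I"]) (rule refl)
  moreover have "sections.independent (frame_section ` balanced_words k)"
    "sections.span (frame_section ` balanced_words k) = parallel_sections M A g k"
    by (rule frame_sections_basis[OF assms(2,14,7)]; rule curved; assumption)+
  ultimately show ?thesis
    unfolding Let_def by (intro conjI ballI) (simp_all only: not_False_eq_True)
qed

end
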